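(* Let $n\ge2$ and let $a_1,\dots,a_{n+1}$, $B_n$, $C_n$ be as in the context. Let $m=\max B_n$ and $\mu=a_{[1,n+1]}$, and set $I_{B_n}=\langle X^{m-b}Y^b: b\in B_n\rangle$ and $I_{C_n}=\langle X^{\mu-c}Y^c:c\in C_n\rangle$. Then: (1) $I_{B_n}$ is an atom of $\mathcal I(R)$; (2) $\{2,n+1\}\subseteq\mathsf L_{\mathcal I(R)}(I_{C_n})\subseteq[2,n+1]$.
   Context: Let $D$ be an integral domain, $N\ge2$, $R=D[X_1,\dots,X_N]$, $X=X_1$, $Y=X_2$. $\mathcal I(R)$ denotes the monoid of nonzero ideals of $R$ under ideal multiplication (identity $R$, whose only unit is $R$). Standing assumption: $\mathcal I(R)$ is a BF-monoid. An atom of $\mathcal I(R)$ is an ideal $I\in\mathcal I(R)$, $I\ne R$, such that $I=\mathfrak a\mathfrak b$ with $\mathfrak a,\mathfrak b\in\mathcal I(R)$ forces $\mathfrak a=R$ or $\mathfrak b=R$. $\mathsf L_{\mathcal I(R)}(I)$ is the set of all $k$ such that $I$ is a product of $k$ atoms of $\mathcal I(R)$. $[x,y]=\{z\in\mathbb Z:x\le z\le y\}$. Fix an integer $n\ge2$ and positive integers $a_1,\dots,a_{n+1}$ with (C1) $a_{n+1}=a_1+\dots+a_{n-1}+2a_n$ and (C2) $a_{i+1}>2(a_1+\dots+a_i)$ for all $i\in[1,n-1]$. For $I\subseteq[1,n+1]$ put $a_I=\sum_{i\in I}a_i$ ($a_\emptyset=0$). Define $A_n=\{a_I:I\subseteq[1,n-1]\}$,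 $B_n=A_n\cup\{a_{[1,n]}\}\cup(A_n+a_{n+1})$, $C_n=\{a_I:I\subseteq[1,n+1]\}$. *)

theory Defs
  imports Main "HOL-Library.Poly_Mapping" "HOL-Library.Cardinality"
begin

(* Polynomial ring D[X_v : v \<in> 'v] over coefficient type 'a, with monomials
   represented as exponent vectors 'v \<Rightarrow>\<^sub>0 nat.  For a finite index type 'v
   with CARD('v) = N this is D[X_1,...,X_N]. *)
type_synonym ('v, 'a) mpoly = "('v \<Rightarrow>\<^sub>0 nat) \<Rightarrow>\<^sub>0 'a"

definition monoXY :: "'v \<Rightarrow> 'v \<Rightarrow> nat \<Rightarrow> nat \<Rightarrow> ('v, 'a::comm_ring_1) mpoly" where
  "monoXY x y i j = Poly_Mapping.single (Poly_Mapping.single x i + Poly_Mapping.single y j) 1"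

definition is_ideal :: "'r::comm_ring_1 set \<Rightarrow> bool" where
  "is_ideal I \<longleftrightarrow> 0 \<in> I \<and> (\<forall>a\<in>I. \<forall>b\<in>I. a + b \<in> I) \<and> (\<forall>r. \<forall>a\<in>I. r * a \<in> I)"

definition ideal_gen :: "'r::comm_ring_1 set \<Rightarrow> 'r set" where
  "ideal_gen S = \<Inter>{I. is_ideal I \<and> S \<subseteq> I}"

definition ideal_mult :: "'r::comm_ring_1 set \<Rightarrow> 'r set \<Rightarrow> 'r set" where
  "ideal_mult I J = ideal_gen {a * b | a b. a \<in> I \<and> b \<in> J}"

definition nz_ideal :: "'r::comm_ring_1 set \<Rightarrow> bool" where
  "nz_ideal I \<longleftrightarrow> is_ideal I \<and> I \<noteq> {0}"

(* atoms of \<I>(R) (the only unit is R = UNIV) *)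
definition ideal_atom :: "'r::comm_ring_1 set \<Rightarrow> bool" where
  "ideal_atom I \<longleftrightarrow> nz_ideal I \<and> I \<noteq> UNIV \<and>
     (\<forall>A B. nz_ideal A \<longrightarrow> nz_ideal B \<longrightarrow> I = ideal_mult A B \<longrightarrow> A = UNIV \<or> B = UNIV)"

definition ideal_prod :: "'r::comm_ring_1 set list \<Rightarrow> 'r set" where
  "ideal_prod Is = foldr ideal_mult Is UNIV"

definition ideal_lengths :: "'r::comm_ring_1 set \<Rightarrow> nat set" where
  "ideal_lengths I = {k. \<exists>Is. length Is = k \<and> (\<forall>A\<in>set Is. ideal_atom A) \<and> ideal_prod Is = I}"

definition ideal_BF :: "'r::comm_ring_1 itself \<Rightarrow> bool" where
  "ideal_BF _ \<longleftrightarrow> (\<forall>I::'r set. nz_ideal I \<and> I \<noteq> UNIV \<longrightarrow>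
      ideal_lengths I \<noteq> {} \<and> finite (ideal_lengths I))"

definition setA :: "(nat \<Rightarrow> nat) \<Rightarrow> nat \<Rightarrow> nat set" where
  "setA a n = (\<lambda>I. \<Sum>i\<in>I. a i) ` Pow {1..n-1}"

definition setB :: "(nat \<Rightarrow> nat) \<Rightarrow> nat \<Rightarrow> nat set" where
  "setB a n = setA a n \<union> {\<Sum>i\<in>{1..n}. a i} \<union> (\<lambda>t. t + a (n+1)) ` setA a n"

definition setC :: "(nat \<Rightarrow> nat) \<Rightarrow> nat \<Rightarrow> nat set" where
  "setC a n = (\<lambda>I. \<Sum>i\<in>I. a i) ` Pow {1..n+1}"

end

theory Submission
  imports Defs "HOL-Computational_Algebra.Polynomial"
begin

text \<open>
  Suppose $I J$ is generated by the monomials $X^{m-b} Y^b$ with $b \in B$ and $0, m \in B$.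
  Dehomogenizing the parts of lowest degree in $X, Y$ of the elements of $I$ and $J$ gives modules
  $V$ and $W$ of polynomials in $Y$ such that $V W$ is spanned by the $Y^b$. The orders at $Y = 0$
  of the elements of $V$ and $W$ form sets $S, T$ containing $0$ with $S + T \subseteq B$, and
  $S = \{0\}$ forces $I$ to be the unit ideal.

  For the set $B_n$, with middle element $c = a_{[1,n]}$: if $c \in S$ then $T = \{0\}$. If $c$
  lies in neither $S$ nor $T$, comparing coefficients in $(f g)(f' g') = (f g')(f' g)$ just above
  degree $c$ shows that no product $f g$ involves $Y^c$, which is absurd.

  If $I_{C_n}$ is a product of $k$ atoms, each factor contributes an order $s_i > 0$, and all subset
  sums of $s_1, \dots, s_k$ lie in $C_n$; the growth of the $a_i$ then forces $k \le n + 1$.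
  The lengths $2$ and $n + 1$ come from $C_n = B_n + \{0, a_n\}$ and
  $C_n = \{0, a_1\} + \dots + \{0, a_{n+1}\}$.
\<close>

section \<open>Ideal arithmetic\<close>

text \<open>The factors are arbitrary ideals, neither homogeneous nor monomial, and Y^b is only a
  sum of products f g. Since terms of such a sum can cancel, orders give just the inclusion of S + T
  in B, and additive indecomposability of B alone does not settle atomicity. The comparison of
  coefficients closes this gap. It works because c is isolated: for k \<le> \<alpha> = a_1 + ... +
  a_(n-1), the exponent c + k splits into two elements of B_n only as c and k.

  Coefficients cannot be divided out over a domain, so elements are compared by
  cross-multiplication; this is why the modules must be closed under scaling by the coefficients of
  their members.

  The factor 2 in (C2) keeps the double of a positive element of A_n out of A_n and leaves gaps that
  sums of small numbers cannot jump. (C1) says c + a_n = a_(n+1), which gives C_n = B_n + {0, a_n};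
  but it also makes a_(n+1) smaller than 2 a_[1,n], so the growth argument for k \<le> n + 1 needs
  extra care at the last term.\<close>

lemma is_ideal_UNIV: "is_ideal UNIV"
  by (simp add: is_ideal_def)

lemma is_ideal_ideal_gen: "is_ideal (ideal_gen S)"
  by (auto simp: is_ideal_def ideal_gen_def)

lemma ideal_gen_superset: "S \<subseteq> ideal_gen S"
  by (auto simp: ideal_gen_def)

lemma ideal_gen_least: "is_ideal I \<Longrightarrow> S \<subseteq> I \<Longrightarrow> ideal_gen S \<subseteq> I"
  by (auto simp: ideal_gen_def)

lemma ideal_gen_self: "is_ideal I \<Longrightarrow> ideal_gen I = I"
  by (rule subset_antisym[OF ideal_gen_least ideal_gen_superset]) auto

lemma ideal_gen_eqI: "S \<subseteq> ideal_gen T \<Longrightarrow> T \<subseteq> ideal_gen S \<Longrightarrow> ideal_gen S = ideal_gen T"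
  by (intro subset_antisym ideal_gen_least is_ideal_ideal_gen)

lemma is_ideal_ideal_mult: "is_ideal (ideal_mult A B)"
  by (simp add: ideal_mult_def is_ideal_ideal_gen)

lemma ideal_mult_mem: "a \<in> A \<Longrightarrow> b \<in> B \<Longrightarrow> a * b \<in> ideal_mult A B"
  unfolding ideal_mult_def by (rule subsetD[OF ideal_gen_superset]) blast

lemma is_ideal_mult_right: "is_ideal A \<Longrightarrow> a \<in> A \<Longrightarrow> a * r \<in> A"
  by (subst mult.commute) (simp add: is_ideal_def)

lemma ideal_mult_commute: "ideal_mult A B = ideal_mult B A"
proof -
  have "{a * b | a b. a \<in> A \<and> b \<in> B} \<subseteq> {b * a | b a. b \<in> B \<and> a \<in> A}" for A B :: "'a set"
  proof clarify
    fix a b assume "a \<in> A" "b \<in> B"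
    then show "\<exists>b' a'. a * b = b' * a' \<and> b' \<in> B \<and> a' \<in> A"
      by (intro exI[of _ b] exI[of _ a]) (simp add: mult.commute)
  qed
  then show ?thesis unfolding ideal_mult_def by (intro arg_cong[where f = ideal_gen] subset_antisym)
qed

text \<open>The colon ideal (I : T). With it, statements about products of two generated ideals
  reduce to \<open>ideal_gen_least\<close>, one factor at a time.\<close>

lemma is_ideal_colon: "is_ideal I \<Longrightarrow> is_ideal {a. \<forall>t\<in>T. a * t \<in> I}"
  by (auto simp: is_ideal_def distrib_right mult.assoc)

lemma ideal_mult_ideal_gen:
  "ideal_mult (ideal_gen S) (ideal_gen T) = ideal_gen {s * t | s t. s \<in> S \<and> t \<in> T}"
proof -
  let ?I = "ideal_gen {s * t | s t. s \<in> S \<and> t \<in> T}"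
  have I: "is_ideal ?I" by (rule is_ideal_ideal_gen)
  have 1: "s * t \<in> ?I" if "s \<in> S" "t \<in> T" for s t
    by (rule subsetD[OF ideal_gen_superset]) (use that in blast)
  have "ideal_gen S \<subseteq> {a. \<forall>t\<in>T. a * t \<in> ?I}"
    by (rule ideal_gen_least[OF is_ideal_colon[OF I]]) (simp add: 1 subset_iff)
  then have 2: "t * s \<in> ?I" if "s \<in> ideal_gen S" "t \<in> T" for s t
    using that by (subst mult.commute) blast
  have "ideal_gen T \<subseteq> {a. \<forall>s\<in>ideal_gen S. a * s \<in> ?I}"
    by (rule ideal_gen_least[OF is_ideal_colon[OF I]]) (simp add: 2 subset_iff)
  then have 3: "s * t \<in> ?I" if "s \<in> ideal_gen S" "t \<in> ideal_gen T" for s t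
    using that by (subst mult.commute) blast
  have "{s * t | s t. s \<in> ideal_gen S \<and> t \<in> ideal_gen T} \<subseteq> ?I"
  proof clarify
    fix s t assume "s \<in> ideal_gen S" "t \<in> ideal_gen T"
    then show "s * t \<in> ?I" by (rule 3)
  qed
  moreover have "{s * t | s t. s \<in> S \<and> t \<in> T} \<subseteq> ideal_gen {s * t | s t. s \<in> ideal_gen S \<and> t \<in> ideal_gen T}"
    by (rule subset_trans[OF _ ideal_gen_superset]) (use ideal_gen_superset[of S] ideal_gen_superset[of T] in blast)
  ultimately show ?thesis unfolding ideal_mult_def by (rule ideal_gen_eqI)
qed

text \<open>Both sides are generated by the triple products.\<close>

lemma ideal_mult_assoc:
  assumes "is_ideal A" "is_ideal B" "is_ideal C"
  shows "ideal_mult (ideal_mult A B) C = ideal_mult A (ideal_mult B C)"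
proof -
  have "ideal_mult (ideal_mult A B) C
    = ideal_gen {s * t | s t. s \<in> {a * b | a b. a \<in> A \<and> b \<in> B} \<and> t \<in> C}"
    unfolding ideal_mult_def[of A B]
    by (subst ideal_gen_self[OF assms(3), symmetric]) (rule ideal_mult_ideal_gen)
  also have "{s * t | s t. s \<in> {a * b | a b. a \<in> A \<and> b \<in> B} \<and> t \<in> C}
    = {s * t | s t. s \<in> A \<and> t \<in> {b * c | b c. b \<in> B \<and> c \<in> C}}"
    by (auto simp: mult.assoc) (metis mult.assoc)+
  also have "ideal_gen \<dots> = ideal_mult A (ideal_mult B C)"
    unfolding ideal_mult_def[of B C]
    by (subst (2) ideal_gen_self[OF assms(1), symmetric]) (rule ideal_mult_ideal_gen[symmetric])
  finally show ?thesis .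
qed

lemma ideal_mult_subset_left:
  assumes "is_ideal A"
  shows "ideal_mult A B \<subseteq> A"
  unfolding ideal_mult_def using assms
  by (intro ideal_gen_least) (auto intro: is_ideal_mult_right)

lemma ideal_mult_UNIV:
  assumes "is_ideal A"
  shows "ideal_mult A UNIV = A"
proof
  show "ideal_mult A UNIV \<subseteq> A"
    by (rule ideal_mult_subset_left[OF assms])
  show "A \<subseteq> ideal_mult A UNIV"
    using ideal_mult_mem[of _ A 1 UNIV] by auto
qed

text \<open>As an intersection, \<open>ideal_gen\<close> gives no expression for its elements.
  Homomorphisms and coefficient extraction need this finite sum; it carries no ring coefficients
  because A absorbs them.\<close>

lemma ideal_mult_sum:
  assumes "is_ideal A" "z \<in> ideal_mult A B"
  shows "\<exists>(N::nat) f g. (\<forall>i<N. f i \<in> A \<and> g i \<in> B) \<and> z = (\<Sum>i<N. f i * g i)"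
proof -
  let ?P = "\<lambda>z. \<exists>(N::nat) f g. (\<forall>i<N. f i \<in> A \<and> g i \<in> B) \<and> z = (\<Sum>i<N. f i * g i)"
  have "is_ideal {z. ?P z}"
    unfolding is_ideal_def
  proof (intro conjI ballI allI)
    show "0 \<in> {z. ?P z}" by (auto intro: exI[of _ 0])
  next
    fix z z' assume "z \<in> {z. ?P z}" "z' \<in> {z. ?P z}"
    then obtain N M :: nat and f g f' g'
      where N: "\<forall>i<N. f i \<in> A \<and> g i \<in> B" "z = (\<Sum>i<N. f i * g i)"
        and M: "\<forall>i<M. f' i \<in> A \<and> g' i \<in> B" "z' = (\<Sum>i<M. f' i * g' i)"
      by auto
    let ?f = "\<lambda>i. if i < N then f i else f' (i - N)" and ?g = "\<lambda>i. if i < N then g i else g' (i - N)"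
    have "(\<Sum>i<N+L. ?f i * ?g i) = z + (\<Sum>i<L. f' i * g' i)" for L
      unfolding N(2) by (induction L) (auto simp: add.assoc)
    then have "z + z' = (\<Sum>i<N+M. ?f i * ?g i)" unfolding M(2) by simp
    moreover have "\<forall>i<N+M. ?f i \<in> A \<and> ?g i \<in> B" using N(1) M(1) by auto
    ultimately show "z + z' \<in> {z. ?P z}" by (intro CollectI exI conjI)
  next
    fix r z assume "z \<in> {z. ?P z}"
    then obtain N :: nat and f g where N: "\<forall>i<N. f i \<in> A \<and> g i \<in> B" "z = (\<Sum>i<N. f i * g i)"
      by auto
    then have "(\<forall>i<N. r * f i \<in> A \<and> g i \<in> B) \<and> r * z = (\<Sum>i<N. (r * f i) * g i)"
      using assms(1) by (auto simp: is_ideal_def sum_distrib_left mult.assoc)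
    then show "r * z \<in> {z. ?P z}" by (intro CollectI exI)
  qed
  moreover have "{a * b | a b. a \<in> A \<and> b \<in> B} \<subseteq> {z. ?P z}"
  proof clarify
    fix a b assume "a \<in> A" "b \<in> B"
    then show "\<exists>(N::nat) f g. (\<forall>i<N. f i \<in> A \<and> g i \<in> B) \<and> a * b = (\<Sum>i<N. f i * g i)"
      by (intro exI[of _ 1] exI[of _ "\<lambda>_. a"] exI[of _ "\<lambda>_. b"]) simp
  qed
  ultimately show ?thesis
    using ideal_gen_least assms(2) unfolding ideal_mult_def by blast
qed

lemma is_ideal_diff: "is_ideal A \<Longrightarrow> a \<in> A \<Longrightarrow> b \<in> A \<Longrightarrow> a - b \<in> A"
proof -
  assume A: "is_ideal A" "a \<in> A" "b \<in> A"
  then have "(- 1) * b \<in> A" unfolding is_ideal_def by blast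
  then have "a + (- 1) * b \<in> A" using A unfolding is_ideal_def by blast
  then show ?thesis by simp
qed

lemma is_ideal_sum: "is_ideal A \<Longrightarrow> (\<And>i. i \<in> T \<Longrightarrow> h i \<in> A) \<Longrightarrow> (\<Sum>i\<in>T. h i) \<in> A"
  by (induction T rule: infinite_finite_induct) (auto simp: is_ideal_def)

lemma is_ideal_two_generators: "is_ideal {X * p + Y * q | p q. True}"
  unfolding is_ideal_def
proof (intro conjI ballI allI; clarify)
  show "\<exists>p q. 0 = X * p + Y * q \<and> True" by (intro exI[of _ 0]) simp
next
  fix p q p' q'
  show "\<exists>p'' q''. X * p + Y * q + (X * p' + Y * q') = X * p'' + Y * q'' \<and> True"
    by (intro exI[of _ "p + p'"] exI[of _ "q + q'"]) (simp add: algebra_simps)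
next
  fix r p q
  show "\<exists>p'' q''. r * (X * p + Y * q) = X * p'' + Y * q'' \<and> True"
    by (intro exI[of _ "r * p"] exI[of _ "r * q"]) (simp add: algebra_simps)
qed

lemma is_ideal_one: "is_ideal A \<Longrightarrow> 1 \<in> A \<Longrightarrow> A = UNIV"
  using is_ideal_mult_right[of A 1] by auto

section \<open>Nilpotent elements modulo an ideal\<close>

lemma diff_dvd_power_diff: "a - b dvd a ^ m - (b :: 'r::comm_ring_1) ^ m"
proof (induction m)
  case (Suc m)
  have "a ^ Suc m - b ^ Suc m = a * (a ^ m - b ^ m) + (a - b) * b ^ m"
    by (simp add: algebra_simps)
  then show ?case using Suc by simp
qed simp

text \<open>Modulo A, u equals -v, and the m-th power of v vanishes.\<close>

lemma is_ideal_add_nilpotent: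
  assumes A: "is_ideal A" and "u + v \<in> A" "v ^ m \<in> A"
  shows "u ^ m \<in> A"
proof -
  have "u + v dvd u ^ m - (- v) ^ m" using diff_dvd_power_diff[of u "- v"] by simp
  then have 1: "u ^ m - (- v) ^ m \<in> A"
    using assms(1,2) by (auto simp: is_ideal_def elim!: dvdE) (metis mult.commute)
  have "(- v) ^ m = (- 1) ^ m * v ^ m" by (rule power_minus)
  then have 2: "(- v) ^ m \<in> A" using A assms(3) by (auto simp: is_ideal_def)
  have "(u ^ m - (- v) ^ m) + (- v) ^ m \<in> A" using A 1 2 unfolding is_ideal_def by blast
  then show ?thesis by simp
qed

text \<open>Modulo A the elements X and Y are nilpotent, so 1 + X p + Y q is a unit there and at the
  same time 0. The two nilpotent summands are stripped off one after the other.\<close>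

lemma is_ideal_UNIV_if_unit_mod_nilpotent:
  assumes A: "is_ideal A" and "1 + X * p + Y * q \<in> A" "X ^ m \<in> A" "Y ^ m \<in> A"
  shows "A = UNIV"
proof -
  have "(X * p) ^ m \<in> A" "(Y * q') ^ m \<in> A" for q'
    using assms by (auto simp: is_ideal_def power_mult_distrib) (metis mult.commute)+
  then have 1: "(1 + Y * q) ^ m \<in> A"
    using assms by (intro is_ideal_add_nilpotent[of A "1 + Y * q" "X * p"]) (auto simp: ac_simps)
  have "(1 + Y * q) - 1 dvd (1 + Y * q) ^ m - 1 ^ m" by (rule diff_dvd_power_diff)
  then obtain r where "(1 + Y * q) ^ m - 1 = Y * q * r" by (auto elim!: dvdE)
  then have "(1 + Y * q) ^ m = 1 + Y * (q * r)" by (simp add: algebra_simps)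
  then have "1 ^ m \<in> A"
    using 1 \<open>\<And>q'. (Y * q') ^ m \<in> A\<close> by (intro is_ideal_add_nilpotent[OF A, of 1 "Y * (q * r)"]) auto
  then show ?thesis using A is_ideal_one by simp
qed

lemma is_ideal_ideal_prod: "(\<And>A. A \<in> set Js \<Longrightarrow> is_ideal A) \<Longrightarrow> is_ideal (ideal_prod Js)"
  by (cases Js) (auto simp: ideal_prod_def is_ideal_UNIV is_ideal_ideal_mult)

lemma ideal_prod_Cons: "ideal_prod (A # Js) = ideal_mult A (ideal_prod Js)"
  by (simp add: ideal_prod_def)

text \<open>Lets any entry of a list act as the first of two factors, so that results on two-factor
  factorizations reach every factor of a longer one.\<close>

lemma ideal_prod_extract:
  assumes "\<And>A. A \<in> set (Ks @ J # Js) \<Longrightarrow> is_ideal A"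
  shows "ideal_prod (Ks @ J # Js) = ideal_mult J (ideal_prod (Ks @ Js))"
  using assms
proof (induction Ks)
  case Nil
  then show ?case by (simp add: ideal_prod_Cons)
next
  case (Cons K Ks)
  have "is_ideal (ideal_prod (Ks @ Js))"
    by (rule is_ideal_ideal_prod, rule Cons.prems) auto
  then have id: "is_ideal K" "is_ideal J" "is_ideal (ideal_prod (Ks @ Js))"
    using Cons.prems by simp_all
  have "ideal_prod ((K # Ks) @ J # Js) = ideal_mult K (ideal_mult J (ideal_prod (Ks @ Js)))"
    using Cons.IH Cons.prems by (simp add: ideal_prod_Cons)
  also have "\<dots> = ideal_mult (ideal_mult K J) (ideal_prod (Ks @ Js))"
    using id by (simp add: ideal_mult_assoc)
  also have "\<dots> = ideal_mult J (ideal_mult K (ideal_prod (Ks @ Js)))"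
    using id by (simp add: ideal_mult_commute[of K J] ideal_mult_assoc)
  finally show ?case by (simp add: ideal_prod_Cons)
qed

section \<open>Products of modules of polynomials\<close>

text \<open>The order at Y = 0, as a relation, so that the zero polynomial simply has none.\<close>

definition lowest :: "'e::zero poly \<Rightarrow> nat \<Rightarrow> bool" where
  "lowest f e \<longleftrightarrow> coeff f e \<noteq> 0 \<and> (\<forall>i<e. coeff f i = 0)"

lemma lowest_exists: "f \<noteq> 0 \<Longrightarrow> \<exists>e. lowest f e"
proof -
  assume "f \<noteq> 0"
  then have "\<exists>e. coeff f e \<noteq> 0" by (simp add: poly_eq_iff)
  then have "\<exists>e. coeff f e \<noteq> 0 \<and> (\<forall>i<e. \<not> coeff f i \<noteq> 0)" by (rule exists_least_iff[THEN iffD1])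
  then show ?thesis by (simp add: lowest_def)
qed

lemma lowest_0_iff: "lowest f 0 \<longleftrightarrow> coeff f 0 \<noteq> 0"
  by (simp add: lowest_def)

lemma coeff_mult_low_eq_0:
  fixes p q :: "'r::comm_semiring_0 poly"
  assumes "\<And>i. i < s \<Longrightarrow> coeff p i = 0" "\<And>j. j < t \<Longrightarrow> coeff q j = 0" "k < s + t"
  shows "coeff (p * q) k = 0"
  unfolding coeff_mult
proof (rule sum.neutral, rule ballI)
  fix i assume "i \<in> {..k}"
  then have "i < s \<or> k - i < t" using assms(3) by auto
  then show "coeff p i * coeff q (k - i) = 0" using assms(1,2) by auto
qed

lemma coeff_mult_lowest_sum:
  fixes p q :: "'r::comm_semiring_0 poly"
  assumes "\<And>i. i < s \<Longrightarrow> coeff p i = 0" "\<And>j. j < t \<Longrightarrow> coeff q j = 0"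
  shows "coeff (p * q) (s + t) = coeff p s * coeff q t"
proof -
  have "coeff (p * q) (s + t) = (\<Sum>i\<le>s+t. coeff p i * coeff q (s + t - i))"
    by (rule coeff_mult)
  also have "\<dots> = (\<Sum>i\<in>{s}. coeff p i * coeff q (s + t - i))"
  proof (rule sum.mono_neutral_right)
    show "\<forall>i\<in>{..s+t} - {s}. coeff p i * coeff q (s + t - i) = 0"
    proof
      fix i assume "i \<in> {..s+t} - {s}"
      then have "i < s \<or> s + t - i < t" by auto
      then show "coeff p i * coeff q (s + t - i) = 0" using assms by auto
    qed
  qed auto
  finally show ?thesis by simp
qed

lemma lowest_mult:
  fixes f g :: "'e::idom poly"
  assumes "lowest f d" "lowest g e"
  shows "lowest (f * g) (d + e)"
  using assms coeff_mult_lowest_sum[of d f e g] coeff_mult_low_eq_0[of d f e g]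
  unfolding lowest_def by auto

text \<open>
  Modules of leading forms are closed only under scaling by coefficients that lift to the ring of
  the ideals; these make up $K$.
\<close>

locale submodule_product =
  fixes K :: "'e::idom set" and V W :: "'e poly set" and B :: "nat set"
  assumes V_add: "f \<in> V \<Longrightarrow> f' \<in> V \<Longrightarrow> f + f' \<in> V"
    and V_diff: "f \<in> V \<Longrightarrow> f' \<in> V \<Longrightarrow> f - f' \<in> V"
    and V_smult: "k \<in> K \<Longrightarrow> f \<in> V \<Longrightarrow> smult k f \<in> V"
    and V_coeff: "f \<in> V \<Longrightarrow> coeff f i \<in> K"
    and W_add: "g \<in> W \<Longrightarrow> g' \<in> W \<Longrightarrow> g + g' \<in> W"
    and W_diff: "g \<in> W \<Longrightarrow> g' \<in> W \<Longrightarrow> g - g' \<in> W"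
    and W_smult: "k \<in> K \<Longrightarrow> g \<in> W \<Longrightarrow> smult k g \<in> W"
    and W_coeff: "g \<in> W \<Longrightarrow> coeff g i \<in> K"
    and mult_supp: "f \<in> V \<Longrightarrow> g \<in> W \<Longrightarrow> coeff (f * g) i \<noteq> 0 \<Longrightarrow> i \<in> B"
    and monom_sum: "b \<in> B \<Longrightarrow> \<exists>(N::nat) f g. (\<forall>i<N. f i \<in> V \<and> g i \<in> W) \<and>
        monom 1 b = (\<Sum>i<N. f i * g i)"
    and zero_in: "0 \<in> B"
begin

lemma swap: "submodule_product K W V B"
proof
  fix b assume "b \<in> B"
  then obtain N :: nat and f g where "\<forall>i<N. f i \<in> V \<and> g i \<in> W" "monom 1 b = (\<Sum>i<N. f i * g i)"
    using monom_sum by blast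
  then have "(\<forall>i<N. g i \<in> W \<and> f i \<in> V) \<and> monom 1 b = (\<Sum>i<N. g i * f i)"
    by (simp add: mult.commute)
  then show "\<exists>(N::nat) f g. (\<forall>i<N. f i \<in> W \<and> g i \<in> V) \<and>
        monom 1 b = (\<Sum>i<N. f i * g i)" by blast
next
  fix f g i assume "f \<in> W" "g \<in> V" "coeff (f * g) i \<noteq> 0"
  then show "i \<in> B" using mult_supp[of g f i] by (simp add: mult.commute)
qed (use V_add V_diff V_smult V_coeff W_add W_diff W_smult W_coeff zero_in in auto)

text \<open>The constant coefficient of Y^0 is the sum of the f_i(0) g_i(0), so one of these is
  nonzero.\<close>

lemma exists_lowest_0: "\<exists>f\<in>V. \<exists>g\<in>W. coeff f 0 \<noteq> 0 \<and> coeff g 0 \<noteq> 0"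
proof (rule ccontr)
  assume *: "\<not> ?thesis"
  obtain N :: nat and f g where fg: "\<forall>i<N. f i \<in> V \<and> g i \<in> W" "monom 1 0 = (\<Sum>i<N. f i * g i)"
    using monom_sum[OF zero_in] by blast
  have "coeff (monom (1::'e) 0) 0 = (\<Sum>i<N. coeff (f i) 0 * coeff (g i) 0)"
    unfolding fg(2) by (simp add: coeff_sum coeff_mult_0)
  also have "\<dots> = 0" using * fg(1) by (intro sum.neutral) auto
  finally show False by simp
qed

lemma sum_mem_W:
  assumes "\<And>i. i < (N::nat) \<Longrightarrow> g i \<in> W"
  shows "(\<Sum>i<N. g i) \<in> W"
proof -
  have "0 \<in> W" using exists_lowest_0 W_diff by (metis diff_self)
  then show ?thesis using assms by (induction N) (auto intro: W_add)
qed

text \<open>A partner in W with nonzero constant coefficient leaves the order unchanged.\<close>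

lemma lowest_in_B:
  assumes "f \<in> V" "lowest f e"
  shows "e \<in> B"
proof -
  obtain g where g: "g \<in> W" "lowest g 0" using exists_lowest_0 by (auto simp: lowest_0_iff)
  then have "lowest (f * g) e" using lowest_mult[OF assms(2) g(2)] by simp
  then show ?thesis using mult_supp[OF assms(1) g(1)] by (auto simp: lowest_def)
qed

lemma lowest_sum_in_B:
  assumes "f \<in> V" "lowest f d" "g \<in> W" "lowest g e"
  shows "d + e \<in> B"
  using lowest_mult[OF assms(2,4)] mult_supp[OF assms(1,3)] by (auto simp: lowest_def)

text \<open>The combination f0(0) f - f(0) f0 has no constant coefficient, so by the gap it vanishes
  below degree k.\<close>

lemma proportional_up_to:
  assumes gap: "\<forall>f\<in>V. \<forall>e. lowest f e \<longrightarrow> e = 0 \<or> k \<le> e"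
    and "f0 \<in> V" "f \<in> V" "i < k"
  shows "coeff f0 0 * coeff f i = coeff f 0 * coeff f0 i"
proof -
  let ?h = "smult (coeff f0 0) f - smult (coeff f 0) f0"
  have h: "?h \<in> V" using assms by (intro V_diff V_smult V_coeff)
  have "coeff ?h 0 = 0" by simp
  have "coeff ?h i = 0"
  proof (cases "?h = 0")
    case False
    then obtain e where e: "lowest ?h e" using lowest_exists by blast
    then have "e \<noteq> 0" using \<open>coeff ?h 0 = 0\<close> by (intro notI) (simp add: lowest_def)
    then have "i < e" using gap[rule_format, OF h e] assms(4) by simp
    then show ?thesis using e by (simp only: lowest_def)
  qed simp
  then show ?thesis by simp
qed

text \<open>Below degree k every member of V is proportional to f0, so after scaling by f0(0) the
  sum of products for Y^b collapses to a single product f0 g.\<close>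

lemma sum_proportional:
  assumes gap: "\<forall>f\<in>V. \<forall>e. lowest f e \<longrightarrow> e = 0 \<or> k \<le> e"
    and "f0 \<in> V" "b \<in> B"
  shows "\<exists>g\<in>W. \<forall>i<k. coeff (smult (coeff f0 0) (monom 1 b)) i = coeff (f0 * g) i"
proof -
  obtain N :: nat and f g where fg: "\<forall>i<N. f i \<in> V \<and> g i \<in> W" "monom 1 b = (\<Sum>i<N. f i * g i)"
    using monom_sum[OF assms(3)] by blast
  let ?g = "\<Sum>i<N. smult (coeff (f i) 0) (g i)"
  have "?g \<in> W" using fg(1) by (intro sum_mem_W W_smult V_coeff) auto
  moreover have "coeff (smult (coeff f0 0) (monom 1 b)) j = coeff (f0 * ?g) j" if "j < k" for j
  proof -
    have "coeff (smult (coeff f0 0) (monom 1 b)) j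
      = (\<Sum>i<N. coeff (smult (coeff f0 0) (f i) * g i) j)"
      unfolding fg(2) by (simp add: coeff_sum sum_distrib_left)
    also have "\<dots> = (\<Sum>i<N. coeff (smult (coeff (f i) 0) f0 * g i) j)"
    proof (rule sum.cong[OF refl])
      fix i assume "i \<in> {..<N}"
      then have "f i \<in> V" using fg by auto
      then have "coeff f0 0 * coeff (f i) l = coeff (f i) 0 * coeff f0 l" if "l < k" for l
        using proportional_up_to[OF gap] assms(2) that by blast
      then show "coeff (smult (coeff f0 0) (f i) * g i) j = coeff (smult (coeff (f i) 0) f0 * g i) j"
        unfolding coeff_mult using \<open>j < k\<close> by (intro sum.cong) auto
    qed
    also have "\<dots> = coeff (f0 * ?g) j"
      by (simp add: coeff_sum sum_distrib_left)
    finally show ?thesis .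
  qed
  ultimately show ?thesis by blast
qed

text \<open>The gap hypothesis holds for every k, so all of V is proportional to f0. The sum for Y^0
  collapses to an exact equation f0(0) = f0 g, and comparing degrees makes f0, hence every f,
  constant.\<close>

lemma constant_if_lowest_0:
  assumes "\<And>f e. f \<in> V \<Longrightarrow> lowest f e \<Longrightarrow> e = 0" and "f \<in> V"
  shows "degree f = 0"
proof -
  have gap: "\<forall>f\<in>V. \<forall>e. lowest f e \<longrightarrow> e = 0 \<or> k \<le> e" for k using assms(1) by blast
  obtain f0 where f0: "f0 \<in> V" "coeff f0 0 \<noteq> 0" using exists_lowest_0 by blast
  obtain N :: nat and h g where hg: "\<forall>i<N. h i \<in> V \<and> g i \<in> W" "monom 1 0 = (\<Sum>i<N. h i * g i)"
    using monom_sum[OF zero_in] by blast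
  have proportional: "smult (coeff f0 0) f = smult (coeff f 0) f0" if "f \<in> V" for f
  proof (rule poly_eqI)
    fix i
    show "coeff (smult (coeff f0 0) f) i = coeff (smult (coeff f 0) f0) i"
      using proportional_up_to[OF gap f0(1) that lessI[of i]] by simp
  qed
  have "[:coeff f0 0:] = smult (coeff f0 0) (monom 1 0)" by (simp add: monom_0)
  also have "\<dots> = (\<Sum>i<N. smult (coeff f0 0) (h i) * g i)"
    unfolding hg(2) by (simp add: poly_eq_iff coeff_sum sum_distrib_left)
  also have "\<dots> = (\<Sum>i<N. smult (coeff (h i) 0) f0 * g i)"
    using proportional hg(1) by (intro sum.cong) auto
  also have "\<dots> = f0 * (\<Sum>i<N. smult (coeff (h i) 0) (g i))"
    by (simp add: sum_distrib_left)
  finally have eq: "[:coeff f0 0:] = f0 * (\<Sum>i<N. smult (coeff (h i) 0) (g i))" .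
  then have "degree f0 = 0"
  proof -
    let ?q = "\<Sum>i<N. smult (coeff (h i) 0) (g i)"
    have "f0 * ?q \<noteq> 0" using f0(2) by (simp flip: eq)
    then have "degree (f0 * ?q) = degree f0 + degree ?q" by (intro degree_mult_eq) auto
    then show ?thesis by (simp flip: eq)
  qed
  then have "degree (smult (coeff f0 0) f) = 0"
    using degree_smult_le[of "coeff f 0" f0] by (simp only: proportional[OF assms(2)])
  then show ?thesis using f0(2) by simp
qed

end

text \<open>If order e occurs in V, no positive order occurs in W, since adding it to e would leave
  B; otherwise V has only order 0.\<close>

lemma (in submodule_product) constant_factor_two:
  assumes B: "B = {0, e}" and "0 < e"
  shows "(\<forall>f\<in>V. degree f = 0) \<or> (\<forall>g\<in>W. degree g = 0)"
proof -
  interpret sw: submodule_product K W V B by (rule swap)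
  show ?thesis
  proof (cases "\<exists>f\<in>V. lowest f e")
    case True
    then obtain f where f: "f \<in> V" "lowest f e" by blast
    have "e' = 0" if "g \<in> W" "lowest g e'" for g e'
      using lowest_sum_in_B[OF f that] B \<open>0 < e\<close> by auto
    then show ?thesis using sw.constant_if_lowest_0 by blast
  next
    case False
    then have "e' = 0" if "f \<in> V" "lowest f e'" for f e'
      using lowest_in_B[OF that] that B by auto
    then show ?thesis using constant_if_lowest_0 by blast
  qed
qed

text \<open>B splits into a low cluster in [0, \<alpha>], the isolated point c and a high cluster in
  (c + \<alpha>, 2 c]. For B_n these are A_n, a_[1,n] and A_n + a_(n+1).\<close>

locale three_cluster_product = submodule_product +
  fixes \<alpha> c :: nat
  assumes low: "b \<in> B \<Longrightarrow> b < c \<Longrightarrow> b \<le> \<alpha>"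
    and high: "b \<in> B \<Longrightarrow> c < b \<Longrightarrow> c + \<alpha> < b"
    and le_2c: "b \<in> B \<Longrightarrow> b \<le> 2 * c"
    and c_in: "c \<in> B"
    and pos_low: "\<exists>e\<in>B. 0 < e \<and> e < c"
    and c_gt: "2 * \<alpha> < c"
    and no_double: "e \<in> B \<Longrightarrow> 0 < e \<Longrightarrow> e \<le> \<alpha> \<Longrightarrow> 2 * e \<notin> B"
begin

lemma swap3: "three_cluster_product K W V B \<alpha> c"
  using swap three_cluster_product_axioms
  by (simp add: three_cluster_product_def three_cluster_product_axioms_def)

text \<open>Two low exponents add up to at most 2 \<alpha> < c, and an exponent above c already
  exceeds c + \<alpha>; so one of the two exponents is c itself.\<close>

lemma coeff_mult_middle:
  assumes "\<And>i. coeff h i \<noteq> 0 \<Longrightarrow> i \<in> B" "\<And>i. coeff h' i \<noteq> 0 \<Longrightarrow> i \<in> B" "k \<le> \<alpha>"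
  shows "coeff (h * h') (c + k) = coeff h c * coeff h' k + coeff h k * coeff h' c"
proof -
  have "coeff (h * h') (c + k) = (\<Sum>i\<le>c+k. coeff h i * coeff h' (c + k - i))"
    by (rule coeff_mult)
  also have "\<dots> = (\<Sum>i\<in>{c, k}. coeff h i * coeff h' (c + k - i))"
  proof (rule sum.mono_neutral_right)
    show "\<forall>i\<in>{..c + k} - {c, k}. coeff h i * coeff h' (c + k - i) = 0"
    proof (rule ballI, rule ccontr)
      fix i assume i: "i \<in> {..c + k} - {c, k}" and "coeff h i * coeff h' (c + k - i) \<noteq> 0"
      then have "coeff h i \<noteq> 0" "coeff h' (c + k - i) \<noteq> 0" by auto
      then have "i \<in> B" "c + k - i \<in> B" using assms(1,2) by blast+
      then show False
        using low[of i] high[of i] low[of "c + k - i"] high[of "c + k - i"] i assms(3) c_gt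
        by (cases "i < c"; cases "c + k - i < c"; cases "c + k - i = c"; simp; linarith)
    qed
  qed auto
  also have "\<dots> = coeff h c * coeff h' k + coeff h k * coeff h' c"
    using assms(3) c_gt by auto
  finally show ?thesis .
qed

text \<open>Compares the two factorizations of $(f g)(f' g')$ in degree $c + k$.\<close>

lemma middle_relation:
  assumes "f \<in> V" "f' \<in> V" "g \<in> W" "g' \<in> W" "k \<le> \<alpha>"
  shows "coeff (f * g) c * coeff (f' * g') k + coeff (f * g) k * coeff (f' * g') c
    = coeff (f * g') c * coeff (f' * g) k + coeff (f * g') k * coeff (f' * g) c"
proof -
  have "(f * g) * (f' * g') = (f * g') * (f' * g)" by (simp add: ac_simps)
  then have "coeff ((f * g) * (f' * g')) (c + k) = coeff ((f * g') * (f' * g)) (c + k)" by (rule arg_cong)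
  then show ?thesis
    using coeff_mult_middle[of "f * g" "f' * g'", OF mult_supp[OF assms(1,3)] mult_supp[OF assms(2,4)] assms(5)]
      coeff_mult_middle[of "f * g'" "f' * g", OF mult_supp[OF assms(1,4)] mult_supp[OF assms(2,3)] assms(5)]
    by metis
qed

lemma exists_middle_nonzero: "\<exists>f\<in>V. \<exists>g\<in>W. coeff (f * g) c \<noteq> 0"
proof (rule ccontr)
  assume *: "\<not> ?thesis"
  obtain N :: nat and f g where fg: "\<forall>i<N. f i \<in> V \<and> g i \<in> W" "monom 1 c = (\<Sum>i<N. f i * g i)"
    using monom_sum[OF c_in] by blast
  have "coeff (monom (1::'a) c) c = (\<Sum>i<N. coeff (f i * g i) c)"
    unfolding fg(2) by (simp add: coeff_sum)
  also have "\<dots> = 0" using * fg(1) by (intro sum.neutral) auto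
  finally show False by simp
qed

text \<open>A low positive e would put c + e into the empty stretch just above c, and e > c would
  push it beyond 2 c.\<close>

lemma lowest_in_0_c:
  assumes "f \<in> V" "lowest f c" "g \<in> W" "lowest g e"
  shows "e = 0 \<or> e = c"
proof -
  interpret sw: three_cluster_product K W V B \<alpha> c by (rule swap3)
  show ?thesis
    using lowest_sum_in_B[OF assms] sw.lowest_in_B[OF assms(3,4)]
      low[of e] high[of "c + e"] le_2c[of "c + e"] by linarith
qed

text \<open>It suffices to exclude order c in W too. Otherwise both modules have no orders strictly
  between 0 and c. For e in B with 0 < e < c, a multiple of Y^e agrees with some f0 g' below c; but
  g' has no constant coefficient, so it vanishes below c.\<close>

lemma constant_if_lowest_c:
  assumes f: "f \<in> V" "lowest f c" and "g \<in> W"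
  shows "degree g = 0"
proof -
  interpret sw: three_cluster_product K W V B \<alpha> c by (rule swap3)
  have "\<not> lowest g c" if g: "g \<in> W" for g
  proof
    assume low_g: "lowest g c"
    have gapV: "\<forall>f\<in>V. \<forall>e. lowest f e \<longrightarrow> e = 0 \<or> c \<le> e"
      using sw.lowest_in_0_c[OF g low_g] by blast
    have gapW: "\<forall>g\<in>W. \<forall>e. lowest g e \<longrightarrow> e = 0 \<or> c \<le> e"
      using lowest_in_0_c[OF f] by blast
    obtain e where e: "e \<in> B" "0 < e" "e < c" using pos_low by blast
    obtain f0 g0 where f0: "f0 \<in> V" "coeff f0 0 \<noteq> 0" and g0: "g0 \<in> W" "coeff g0 0 \<noteq> 0"
      using exists_lowest_0 by blast
    obtain g' where g': "g' \<in> W"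
      "\<And>i. i < c \<Longrightarrow> coeff (smult (coeff f0 0) (monom 1 e)) i = coeff (f0 * g') i"
      using sum_proportional[OF gapV f0(1) e(1)] by blast
    have "coeff g' 0 = 0"
      using g'(2)[of 0] e f0 by (simp add: coeff_mult_0)
    then have g'0: "coeff g' i = 0" if "i < c" for i
      using sw.proportional_up_to[OF gapW g0(1) g'(1) that] g0(2) by simp
    have "coeff (f0 * g') e = 0"
      using coeff_mult_low_eq_0[of 0 f0 c g' e] g'0 e by simp
    then show False using g'(2)[of e] e f0 by simp
  qed
  then have "e = 0" if "g \<in> W" "lowest g e" for g e
    using lowest_in_0_c[OF f that] that by blast
  then show ?thesis using sw.constant_if_lowest_0 assms(3) by blast
qed

text \<open>If V had no such order, its orders would be 0 or above c, so f0(0) Y^c would agree with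
  some f0 g through degree c, and g would have the excluded order c.\<close>

lemma lowest_below_c:
  assumes "\<And>g. g \<in> W \<Longrightarrow> \<not> lowest g c" "\<And>f. f \<in> V \<Longrightarrow> \<not> lowest f c"
  shows "\<exists>f\<in>V. \<exists>e. lowest f e \<and> 0 < e \<and> e < c"
proof (rule ccontr)
  assume *: "\<not> ?thesis"
  \<comment> \<open>The bound is \<open>Suc c\<close> because the agreement must include degree c
    itself.\<close>
  have gap: "\<forall>f\<in>V. \<forall>e. lowest f e \<longrightarrow> e = 0 \<or> Suc c \<le> e"
  proof (intro ballI allI impI)
    fix f e assume fe: "f \<in> V" "lowest f e"
    then have "e \<noteq> c" "\<not> (0 < e \<and> e < c)" using * assms(2) by blast+
    then show "e = 0 \<or> Suc c \<le> e" by linarith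
  qed
  obtain f0 where f0: "f0 \<in> V" "coeff f0 0 \<noteq> 0" using exists_lowest_0 by blast
  obtain g where g: "g \<in> W"
    "\<And>i. i < Suc c \<Longrightarrow> coeff (smult (coeff f0 0) (monom 1 c)) i = coeff (f0 * g) i"
    using sum_proportional[OF gap f0(1) c_in] by blast
  have "coeff (f0 * g) c \<noteq> 0" using g(2)[of c] f0 by simp
  then have "g \<noteq> 0" by auto
  then obtain e where e: "lowest g e" using lowest_exists by blast
  have "lowest (f0 * g) (0 + e)" using f0(2) by (intro lowest_mult e) (simp add: lowest_0_iff)
  then have low: "coeff (f0 * g) e \<noteq> 0" "\<forall>i<e. coeff (f0 * g) i = 0" by (auto simp: lowest_def)
  have "e \<le> c" using low(2) \<open>coeff (f0 * g) c \<noteq> 0\<close> by (meson linorder_not_le)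
  then have "e = c" using g(2)[of e] low(1) by (auto split: if_splits)
  then show False using e assms(1)[OF g(1)] by simp
qed

text \<open>The products f0 g0, f1 g0, f0 g1, f1 g1 have orders 0, d, e, d + e. Evaluated at k = 0,
  d, e, d + e in turn, the relation leaves one term each time and kills the coefficient at c of f1
  g1, f0 g1, f1 g0 and finally f0 g0.\<close>

lemma middle_eq_0:
  assumes f1: "f1 \<in> V" "lowest f1 d" "0 < d" "d < c"
    and g1: "g1 \<in> W" "lowest g1 e" "d < e" "e < c"
    and f0: "f0 \<in> V" "coeff f0 0 \<noteq> 0" and g0: "g0 \<in> W" "coeff g0 0 \<noteq> 0"
  shows "coeff (f0 * g0) c = 0"
proof -
  interpret sw: three_cluster_product K W V B \<alpha> c by (rule swap3)
  have de: "d \<le> \<alpha>" "e \<le> \<alpha>"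
    using lowest_in_B[OF f1(1,2)] sw.lowest_in_B[OF g1(1,2)] low f1 g1 by auto
  then have "d + e \<le> \<alpha>" using lowest_sum_in_B[OF f1(1,2) g1(1,2)] low[of "d + e"] c_gt by simp
  note rel = middle_relation[OF f0(1) f1(1) g0(1) g1(1)]
  have l00: "lowest (f0 * g0) (0 + 0)" and l01: "lowest (f0 * g1) (0 + e)"
    and l10: "lowest (f1 * g0) (d + 0)" and l11: "lowest (f1 * g1) (d + e)"
    by (rule lowest_mult; use f0 g0 f1 g1 in \<open>simp add: lowest_0_iff\<close>)+
  note l = l00[unfolded lowest_def] l01[unfolded lowest_def] l10[unfolded lowest_def] l11[unfolded lowest_def]
  have "coeff (f1 * g1) c = 0" using rel[of 0] l f1(3) g1(3) by auto
  \<comment> \<open>This is where d < e enters: f0 g1 has no coefficient in degree d.\<close>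
  moreover have "coeff (f0 * g1) c = 0" using rel[of d] l f1(3) g1(3) de calculation by auto
  moreover have "coeff (f1 * g0) c = 0" using rel[of e] l f1(3) g1(3) de calculation by auto
  ultimately show ?thesis using rel[of "d + e"] l \<open>d + e \<le> \<alpha>\<close> by auto
qed

text \<open>The coefficient at c is bilinear. If it vanished on all pairs with nonzero constant
  coefficients, adding f0 or g0 would spread the vanishing to all pairs.\<close>

lemma middle_nonzero_lowest_0:
  "\<exists>f\<in>V. \<exists>g\<in>W. coeff f 0 \<noteq> 0 \<and> coeff g 0 \<noteq> 0 \<and> coeff (f * g) c \<noteq> 0"
proof (rule ccontr)
  assume "\<not> ?thesis"
  then have *: "coeff (f * g) c = 0" if "f \<in> V" "g \<in> W" "coeff f 0 \<noteq> 0" "coeff g 0 \<noteq> 0" for f g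
    using that by blast
  obtain f0 g0 where f0: "f0 \<in> V" "coeff f0 0 \<noteq> 0" and g0: "g0 \<in> W" "coeff g0 0 \<noteq> 0"
    using exists_lowest_0 by blast
  have **: "coeff (f * g) c = 0" if "f \<in> V" "g \<in> W" "coeff g 0 \<noteq> 0" for f g
  proof (cases "coeff f 0 = 0")
    case True
    then have "coeff ((f0 + f) * g) c = 0" using that f0 by (intro *) (auto intro: V_add)
    then show ?thesis using *[OF f0(1) that(2) f0(2) that(3)] by (simp add: distrib_right)
  qed (use * that in auto)
  have "coeff (f * g) c = 0" if "f \<in> V" "g \<in> W" for f g
  proof (cases "coeff g 0 = 0")
    case True
    then have "coeff (f * (g0 + g)) c = 0" using that g0 by (intro **) (auto intro: W_add)
    then show ?thesis using **[OF that(1) g0] by (simp add: distrib_left)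
  qed (use ** that in auto)
  then show False using exists_middle_nonzero by blast
qed

text \<open>If neither module is constant, order c is absent on both sides, so both have orders
  strictly between 0 and c. These differ, since d + d is not in B, and \<open>middle_eq_0\<close>
  applies with the smaller order first.\<close>

lemma constant_factor:
  "(\<forall>f\<in>V. degree f = 0) \<or> (\<forall>g\<in>W. degree g = 0)"
proof (rule ccontr)
  interpret sw: three_cluster_product K W V B \<alpha> c by (rule swap3)
  assume "\<not> ?thesis"
  then have noV: "\<And>f. f \<in> V \<Longrightarrow> \<not> lowest f c" and noW: "\<And>g. g \<in> W \<Longrightarrow> \<not> lowest g c"
    using constant_if_lowest_c sw.constant_if_lowest_c by blast+
  obtain f1 d where f1: "f1 \<in> V" "lowest f1 d" "0 < d" "d < c"
    using lowest_below_c[OF noW noV] by blast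
  obtain g1 e where g1: "g1 \<in> W" "lowest g1 e" "0 < e" "e < c"
    using sw.lowest_below_c[OF noV noW] by blast
  have dB: "d \<in> B" using lowest_in_B[OF f1(1,2)] .
  have "d \<noteq> e"
    using lowest_sum_in_B[OF f1(1,2) g1(1,2)] no_double[OF dB f1(3) low[OF dB f1(4)]]
    by (auto simp: mult_2)
  then have "coeff (f * g) c = 0"
    if "f \<in> V" "g \<in> W" "coeff f 0 \<noteq> 0" "coeff g 0 \<noteq> 0" for f g
    using middle_eq_0[OF f1 g1(1,2) _ g1(4) that(1,3,2,4)]
      sw.middle_eq_0[OF g1 f1(1,2) _ f1(4) that(2,4,1,3)]
    by (cases "d < e") (auto simp: mult.commute)
  then show False using middle_nonzero_lowest_0 by blast
qed

end

section \<open>Leading forms of ideals\<close>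

text \<open>The interface between ring and forms. \<open>coeff_lift\<close> turns coefficients of
  forms into ring elements, and \<open>form_0\<close> lets the part of degree 0 decide membership in
  (X, Y).\<close>

locale form_grading =
  fixes \<pi> :: "'r::comm_ring_1 \<Rightarrow> 'e::idom poly poly" and X Y :: 'r
  assumes map_add: "\<pi> (f + g) = \<pi> f + \<pi> g"
    and map_mult: "\<pi> (f * g) = \<pi> f * \<pi> g"
    and map_X: "\<pi> X = monom 1 1"
    and map_Y: "\<pi> Y = monom (monom 1 1) 1"
    and degree_form: "degree (coeff (\<pi> f) d) \<le> d"
    and coeff_lift: "\<exists>r. \<pi> r = [:[:coeff (coeff (\<pi> f) d) j:]:]"
    and form_0: "coeff (\<pi> f) 0 = 0 \<Longrightarrow> \<exists>p q. f = X * p + Y * q"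
begin

lemma map_zero: "\<pi> 0 = 0"
proof -
  have "\<pi> 0 + \<pi> 0 = \<pi> 0 + 0" using map_add[of 0 0] by simp
  then show ?thesis by (simp only: add_left_cancel)
qed

lemma map_diff: "\<pi> (f - g) = \<pi> f - \<pi> g"
  using map_add[of "f - g" g] by (simp add: algebra_simps)

lemma map_one: "\<pi> 1 = 1"
proof -
  have "\<pi> X \<noteq> 0" by (simp add: map_X)
  moreover have "\<pi> X * \<pi> 1 = \<pi> X * 1" unfolding map_mult[symmetric] by simp
  ultimately show ?thesis by (metis mult_left_cancel)
qed

lemma map_sum: "\<pi> (\<Sum>i\<in>T. h i) = (\<Sum>i\<in>T. \<pi> (h i))"
  by (induction T rule: infinite_finite_induct) (simp_all add: map_zero map_add)

lemma map_power: "\<pi> (f ^ k) = \<pi> f ^ k"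
  by (induction k) (simp_all add: map_one map_mult)

lemma map_monomial: "\<pi> (X ^ i * Y ^ j) = monom (monom 1 j) (i + j)"
  by (simp add: map_mult map_power map_X map_Y monom_power mult_monom)

text \<open>Guards \<open>lead_deg\<close>: for a set killed by \<pi> the \<open>LEAST\<close> would
  range over nothing.\<close>

definition nontrivial :: "'r set \<Rightarrow> bool" where
  "nontrivial A \<longleftrightarrow> (\<exists>f\<in>A. \<pi> f \<noteq> 0)"

definition lead_deg :: "'r set \<Rightarrow> nat" where
  "lead_deg A = (LEAST d. \<exists>f\<in>A. coeff (\<pi> f) d \<noteq> 0)"

definition lead_forms :: "'r set \<Rightarrow> 'e poly set" where
  "lead_forms A = (\<lambda>f. coeff (\<pi> f) (lead_deg A)) ` A"

definition lead_orders :: "'r set \<Rightarrow> nat set" where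
  "lead_orders A = {e. \<exists>v\<in>lead_forms A. lowest v e}"

definition const_coeffs :: "'e set" where
  "const_coeffs = {e. \<exists>r. \<pi> r = [:[:e:]:]}"

lemma coeff_below_lead_deg: "f \<in> A \<Longrightarrow> d < lead_deg A \<Longrightarrow> coeff (\<pi> f) d = 0"
  unfolding lead_deg_def using not_less_Least[of d "\<lambda>d. \<exists>f\<in>A. coeff (\<pi> f) d \<noteq> 0"] by blast

lemma exists_lead:
  assumes "nontrivial A"
  shows "\<exists>f\<in>A. coeff (\<pi> f) (lead_deg A) \<noteq> 0"
proof -
  have "\<exists>d. \<exists>f\<in>A. coeff (\<pi> f) d \<noteq> 0"
    using assms unfolding nontrivial_def by (metis leading_coeff_0_iff)
  then show ?thesis unfolding lead_deg_def by (rule LeastI_ex)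
qed

lemma lead_deg_eqI:
  assumes "f \<in> A" "coeff (\<pi> f) d \<noteq> 0" "\<And>g i. g \<in> A \<Longrightarrow> i < d \<Longrightarrow> coeff (\<pi> g) i = 0"
  shows "lead_deg A = d"
  unfolding lead_deg_def
proof (rule Least_equality)
  show "\<exists>f\<in>A. coeff (\<pi> f) d \<noteq> 0" using assms by blast
  show "d \<le> i" if "\<exists>f\<in>A. coeff (\<pi> f) i \<noteq> 0" for i
    using that assms(3) by (meson linorder_not_le)
qed

lemma nontrivialI: "f \<in> A \<Longrightarrow> coeff (\<pi> f) d \<noteq> 0 \<Longrightarrow> nontrivial A"
  unfolding nontrivial_def by (metis coeff_0)

lemma coeff_lead_mult:
  "f \<in> A \<Longrightarrow> g \<in> B \<Longrightarrow> coeff (\<pi> (f * g)) (lead_deg A + lead_deg B)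
    = coeff (\<pi> f) (lead_deg A) * coeff (\<pi> g) (lead_deg B)"
  unfolding map_mult by (rule coeff_mult_lowest_sum) (auto intro: coeff_below_lead_deg)

text \<open>A product of two nonzero lowest forms is nonzero over a domain, and sums of products
  cannot reach a lower degree.\<close>

lemma lead_deg_mult:
  assumes "is_ideal A" "nontrivial A" "nontrivial B"
  shows "lead_deg (ideal_mult A B) = lead_deg A + lead_deg B" "nontrivial (ideal_mult A B)"
proof -
  obtain f g where f: "f \<in> A" "coeff (\<pi> f) (lead_deg A) \<noteq> 0"
    and g: "g \<in> B" "coeff (\<pi> g) (lead_deg B) \<noteq> 0"
    using exists_lead[OF assms(2)] exists_lead[OF assms(3)] by blast
  have fg: "f * g \<in> ideal_mult A B" "coeff (\<pi> (f * g)) (lead_deg A + lead_deg B) \<noteq> 0"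
    using f g by (auto intro: ideal_mult_mem simp: coeff_lead_mult)
  have "coeff (\<pi> z) i = 0" if z: "z \<in> ideal_mult A B" and i: "i < lead_deg A + lead_deg B" for z i
  proof -
    obtain N :: nat and f g where fg: "\<forall>j<N. f j \<in> A \<and> g j \<in> B" "z = (\<Sum>j<N. f j * g j)"
      using ideal_mult_sum[OF assms(1) z] by blast
    have "coeff (\<pi> (f j * g j)) i = 0" if "j < N" for j
      unfolding map_mult
      by (rule coeff_mult_low_eq_0[OF _ _ i]) (use fg that in \<open>auto intro: coeff_below_lead_deg\<close>)
    then show ?thesis by (simp add: fg(2) map_sum coeff_sum)
  qed
  then show "lead_deg (ideal_mult A B) = lead_deg A + lead_deg B"
    using lead_deg_eqI[OF fg] by blast
  show "nontrivial (ideal_mult A B)" using fg by (rule nontrivialI)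
qed

lemma lead_orders_mult:
  assumes "is_ideal A" "nontrivial A" "nontrivial B" "d \<in> lead_orders A" "e \<in> lead_orders B"
  shows "d + e \<in> lead_orders (ideal_mult A B)"
proof -
  obtain f g where f: "f \<in> A" "lowest (coeff (\<pi> f) (lead_deg A)) d"
    and g: "g \<in> B" "lowest (coeff (\<pi> g) (lead_deg B)) e"
    using assms(4,5) by (auto simp: lead_orders_def lead_forms_def)
  have "lowest (coeff (\<pi> (f * g)) (lead_deg (ideal_mult A B))) (d + e)"
    using lowest_mult[OF f(2) g(2)] f g assms by (simp add: lead_deg_mult coeff_lead_mult)
  then show ?thesis
    using ideal_mult_mem[OF f(1) g(1)] by (auto simp: lead_orders_def lead_forms_def)
qed

lemma lead_UNIV: "lead_deg UNIV = 0" "nontrivial UNIV" "0 \<in> lead_orders UNIV"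
proof -
  show deg: "lead_deg UNIV = 0" by (rule lead_deg_eqI[of 1]) (auto simp: map_one)
  show "nontrivial UNIV" by (rule nontrivialI[of 1 _ 0]) (auto simp: map_one)
  have "coeff (\<pi> 1) 0 \<in> lead_forms UNIV" by (simp add: lead_forms_def deg)
  moreover have "lowest (coeff (\<pi> 1) 0) 0" by (simp add: map_one lowest_0_iff)
  ultimately show "0 \<in> lead_orders UNIV" by (auto simp: lead_orders_def)
qed

lemma lead_orders_ideal_prod:
  assumes "list_all2 (\<lambda>J e. is_ideal J \<and> nontrivial J \<and> e \<in> lead_orders J) Js es"
  shows "nontrivial (ideal_prod Js) \<and> sum_list es \<in> lead_orders (ideal_prod Js)"
  using assms
proof (induction rule: list_all2_induct)
  case Nil
  then show ?case by (simp add: ideal_prod_def lead_UNIV)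
next
  case (Cons J Js e es)
  then show ?case by (simp add: ideal_prod_Cons lead_orders_mult lead_deg_mult)
qed

lemma lead_forms_smult:
  assumes "is_ideal A" "k \<in> const_coeffs" "v \<in> lead_forms A"
  shows "smult k v \<in> lead_forms A"
proof -
  obtain f r where f: "f \<in> A" "v = coeff (\<pi> f) (lead_deg A)" and r: "\<pi> r = [:[:k:]:]"
    using assms(2,3) by (auto simp: lead_forms_def const_coeffs_def)
  have "coeff (\<pi> (r * f)) (lead_deg A) = smult k v" by (simp add: map_mult r f(2))
  moreover have "r * f \<in> A" using assms(1) f(1) by (simp add: is_ideal_def)
  ultimately show ?thesis unfolding lead_forms_def by (metis image_eqI)
qed

lemma lead_forms_add:
  assumes "is_ideal A" "v \<in> lead_forms A" "w \<in> lead_forms A"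
  shows "v + w \<in> lead_forms A" "v - w \<in> lead_forms A"
proof -
  obtain f g where "f \<in> A" "v = coeff (\<pi> f) (lead_deg A)" "g \<in> A" "w = coeff (\<pi> g) (lead_deg A)"
    using assms(2,3) by (auto simp: lead_forms_def)
  then have "v + w = coeff (\<pi> (f + g)) (lead_deg A)" "f + g \<in> A"
    "v - w = coeff (\<pi> (f - g)) (lead_deg A)" "f - g \<in> A"
    using assms(1) is_ideal_diff by (auto simp: is_ideal_def map_add map_diff)
  then show "v + w \<in> lead_forms A" "v - w \<in> lead_forms A" unfolding lead_forms_def by auto
qed

lemma lead_forms_coeff: "v \<in> lead_forms A \<Longrightarrow> coeff v i \<in> const_coeffs"
  using coeff_lift by (auto simp: lead_forms_def const_coeffs_def)

lemma degree_lead_form: "w \<in> lead_forms A \<Longrightarrow> degree w \<le> lead_deg A"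
  by (auto simp: lead_forms_def degree_form)

section \<open>Ideals generated by monomials of a common degree\<close>

definition mono_ideal :: "nat \<Rightarrow> nat set \<Rightarrow> 'r set" where
  "mono_ideal m B = ideal_gen ((\<lambda>b. X ^ (m - b) * Y ^ b) ` B)"

lemma is_ideal_mono_ideal: "is_ideal (mono_ideal m B)"
  by (simp add: mono_ideal_def is_ideal_ideal_gen)

lemma mono_ideal_mem: "b \<in> B \<Longrightarrow> X ^ (m - b) * Y ^ b \<in> mono_ideal m B"
  unfolding mono_ideal_def by (rule subsetD[OF ideal_gen_superset]) blast

lemma mono_ideal_mult:
  assumes "B \<subseteq> {..m}" "C \<subseteq> {..k}"
  shows "ideal_mult (mono_ideal m B) (mono_ideal k C) = mono_ideal (m + k) {b + c | b c. b \<in> B \<and> c \<in> C}"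
proof -
  have eq: "(X ^ (m - b) * Y ^ b) * (X ^ (k - c) * Y ^ c) = X ^ (m + k - (b + c)) * Y ^ (b + c)"
    if "b \<in> B" "c \<in> C" for b c
  proof -
    have "b \<le> m" "c \<le> k" using that assms by auto
    then have "m + k - (b + c) = (m - b) + (k - c)" by simp
    then show ?thesis by (simp add: power_add ac_simps)
  qed
  have "{s * t | s t. s \<in> (\<lambda>b. X ^ (m - b) * Y ^ b) ` B \<and> t \<in> (\<lambda>c. X ^ (k - c) * Y ^ c) ` C}
    = (\<lambda>b. X ^ (m + k - b) * Y ^ b) ` {b + c | b c. b \<in> B \<and> c \<in> C}" (is "?L = ?R")
  proof
    show "?L \<subseteq> ?R" using eq by blast
    show "?R \<subseteq> ?L"
    proof clarify
      fix b c assume bc: "b \<in> B" "c \<in> C"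
      show "\<exists>s t. X ^ (m + k - (b + c)) * Y ^ (b + c) = s * t \<and>
        s \<in> (\<lambda>b. X ^ (m - b) * Y ^ b) ` B \<and> t \<in> (\<lambda>c. X ^ (k - c) * Y ^ c) ` C"
        using eq[OF bc, symmetric] bc by blast
    qed
  qed
  then show ?thesis unfolding mono_ideal_def ideal_mult_ideal_gen by simp
qed

text \<open>In degree m a multiplier r acts only through its part of degree 0, which is constant in
  Y by \<open>degree_form\<close>; so exponents outside B cannot appear.\<close>

lemma mono_ideal_coeffs:
  assumes "B \<subseteq> {..m}" "f \<in> mono_ideal m B"
  shows "d < m \<Longrightarrow> coeff (\<pi> f) d = 0" "coeff (coeff (\<pi> f) m) j \<noteq> 0 \<Longrightarrow> j \<in> B"
proof -
  let ?I = "{f. (\<forall>d<m. coeff (\<pi> f) d = 0) \<and> (\<forall>j. j \<notin> B \<longrightarrow> coeff (coeff (\<pi> f) m) j = 0)}"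
  have "is_ideal ?I"
    unfolding is_ideal_def
  proof (intro conjI ballI allI)
    fix r f assume f: "f \<in> ?I"
    have low: "coeff (\<pi> (r * f)) d = 0" if "d < m" for d
      unfolding map_mult using coeff_mult_low_eq_0[of 0 "\<pi> r" m "\<pi> f" d] f that by simp
    have "coeff (\<pi> (r * f)) m = coeff (\<pi> r) 0 * coeff (\<pi> f) m"
      unfolding map_mult using coeff_mult_lowest_sum[of 0 "\<pi> r" m "\<pi> f"] f by simp
    moreover obtain e where "coeff (\<pi> r) 0 = [:e:]"
      using degree_form[of r 0] by (metis degree_eq_zeroE le_zero_eq)
    ultimately have "coeff (coeff (\<pi> (r * f)) m) j = e * coeff (coeff (\<pi> f) m) j" for j
      by simp
    then show "r * f \<in> ?I" using f low by simp
  qed (auto simp: map_zero map_add)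
  moreover have "(\<lambda>b. X ^ (m - b) * Y ^ b) ` B \<subseteq> ?I"
    using assms(1) by (auto simp: map_monomial)
  ultimately have "ideal_gen ((\<lambda>b. X ^ (m - b) * Y ^ b) ` B) \<subseteq> ?I" by (rule ideal_gen_least)
  then have "f \<in> ?I" using assms(2) unfolding mono_ideal_def by (rule subsetD)
  then show "d < m \<Longrightarrow> coeff (\<pi> f) d = 0" "coeff (coeff (\<pi> f) m) j \<noteq> 0 \<Longrightarrow> j \<in> B" by auto
qed

lemma lead_deg_mono_ideal:
  assumes "B \<subseteq> {..m}" "b \<in> B"
  shows "lead_deg (mono_ideal m B) = m"
proof (rule lead_deg_eqI[OF mono_ideal_mem[OF assms(2)]])
  show "coeff (\<pi> (X ^ (m - b) * Y ^ b)) m \<noteq> 0"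
    using assms by (auto simp: map_monomial)
qed (rule mono_ideal_coeffs(1)[OF assms(1)])

lemma lead_orders_mono_ideal:
  assumes "B \<subseteq> {..m}"
  shows "lead_orders (mono_ideal m B) \<subseteq> B"
proof (cases "B = {}")
  case False
  then have "lead_deg (mono_ideal m B) = m" using lead_deg_mono_ideal assms by blast
  then show ?thesis using mono_ideal_coeffs(2)[OF assms]
    by (auto simp: lead_orders_def lead_forms_def lowest_def)
next
  case True
  have "is_ideal {0::'r}" by (simp add: is_ideal_def)
  then have "mono_ideal m B \<subseteq> {0}" unfolding mono_ideal_def True by (intro ideal_gen_least) auto
  then show ?thesis by (auto simp: lead_orders_def lead_forms_def lowest_def map_zero)
qed

lemma mono_ideal_proper:
  assumes "B \<subseteq> {..m}" "0 < m"
  shows "mono_ideal m B \<noteq> UNIV"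
proof
  assume "mono_ideal m B = UNIV"
  then have "coeff (\<pi> 1) 0 = 0" by (intro mono_ideal_coeffs(1)[OF assms(1) _ assms(2)]) simp
  then show False by (simp add: map_one)
qed

lemma nz_mono_ideal:
  assumes "b \<in> B"
  shows "nz_ideal (mono_ideal m B)"
proof -
  have "\<pi> (X ^ (m - b) * Y ^ b) \<noteq> 0" by (simp add: map_monomial)
  then have "X ^ (m - b) * Y ^ b \<noteq> 0" using map_zero by metis
  then show ?thesis using mono_ideal_mem[OF assms, of m] is_ideal_mono_ideal
    by (auto simp: nz_ideal_def)
qed

end

section \<open>Factorizations of a monomial ideal into two ideals\<close>

locale mono_ideal_factorization = form_grading +
  fixes m :: nat and B :: "nat set" and I J :: "'a set"
  assumes B_le: "B \<subseteq> {..m}" and B_0: "0 \<in> B" and B_m: "m \<in> B"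
    and ideal_I: "is_ideal I" and ideal_J: "is_ideal J"
    and factorization: "ideal_mult I J = mono_ideal m B"
begin

lemma swap_factors: "mono_ideal_factorization \<pi> X Y m B J I"
  by unfold_locales (use B_le B_0 B_m ideal_I ideal_J factorization in \<open>auto simp: ideal_mult_commute\<close>)

lemma monomial_sum:
  assumes "b \<in> B"
  shows "\<exists>(N::nat) f g. (\<forall>i<N. f i \<in> I \<and> g i \<in> J) \<and> X ^ (m - b) * Y ^ b = (\<Sum>i<N. f i * g i)"
  using mono_ideal_mem[OF assms, of m] unfolding factorization[symmetric]
  by (rule ideal_mult_sum[OF ideal_I])

lemma nontrivial_I: "nontrivial I"
proof (rule ccontr)
  assume *: "\<not> nontrivial I"
  obtain N :: nat and f g where fg: "\<forall>i<N. f i \<in> I \<and> g i \<in> J" "X ^ (m - 0) * Y ^ 0 = (\<Sum>i<N. f i * g i)"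
    using monomial_sum[OF B_0] by blast
  have "\<pi> (X ^ (m - 0) * Y ^ 0) = 0"
    unfolding fg(2) using * fg(1) by (simp add: map_sum map_mult nontrivial_def)
  then show False by (simp add: map_monomial del: power_0)
qed

lemma nontrivial_J: "nontrivial J"
proof -
  interpret sw: mono_ideal_factorization \<pi> X Y m B J I by (rule swap_factors)
  show ?thesis by (rule sw.nontrivial_I)
qed

lemma lead_deg_sum: "lead_deg I + lead_deg J = m"
  using lead_deg_mult(1)[OF ideal_I nontrivial_I nontrivial_J] lead_deg_mono_ideal[OF B_le B_0]
  by (simp add: factorization)

text \<open>This is the part of degree m of the sum for X^(m-b) Y^b. Since m is the sum of the
  leading degrees, each product contributes exactly the product of its leading parts.\<close>

lemma coeff_monomial_sum:
  assumes "b \<in> B"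
  shows "\<exists>(N::nat) f g. (\<forall>i<N. f i \<in> I \<and> g i \<in> J) \<and>
    monom 1 b = (\<Sum>i<N. coeff (\<pi> (f i)) (lead_deg I) * coeff (\<pi> (g i)) (lead_deg J))"
proof -
  obtain N :: nat and f g where fg: "\<forall>i<N. f i \<in> I \<and> g i \<in> J" "X ^ (m - b) * Y ^ b = (\<Sum>i<N. f i * g i)"
    using monomial_sum[OF assms] by blast
  have "monom 1 b = coeff (\<pi> (X ^ (m - b) * Y ^ b)) m"
    using assms B_le by (auto simp: map_monomial)
  also have "\<dots> = (\<Sum>i<N. coeff (\<pi> (f i * g i)) (lead_deg I + lead_deg J))"
    unfolding fg(2) by (simp add: map_sum coeff_sum lead_deg_sum)
  also have "\<dots> = (\<Sum>i<N. coeff (\<pi> (f i)) (lead_deg I) * coeff (\<pi> (g i)) (lead_deg J))"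
    using fg(1) by (intro sum.cong) (auto simp: coeff_lead_mult)
  finally show ?thesis using fg(1) by blast
qed

sublocale submodule_product const_coeffs "lead_forms I" "lead_forms J" B
proof
  fix v w i assume "v \<in> lead_forms I" "w \<in> lead_forms J" and nz: "coeff (v * w) i \<noteq> 0"
  then obtain f g where fg: "f \<in> I" "g \<in> J" "v = coeff (\<pi> f) (lead_deg I)" "w = coeff (\<pi> g) (lead_deg J)"
    by (auto simp: lead_forms_def)
  have "f * g \<in> mono_ideal m B" using ideal_mult_mem fg factorization by blast
  moreover have "coeff (coeff (\<pi> (f * g)) m) i \<noteq> 0"
    using nz fg coeff_lead_mult[OF fg(1,2)] by (simp add: lead_deg_sum)
  ultimately show "i \<in> B" using mono_ideal_coeffs(2)[OF B_le] by blast
next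
  fix b assume "b \<in> B"
  then obtain N :: nat and f g where fg: "\<forall>i<N. f i \<in> I \<and> g i \<in> J"
    "monom 1 b = (\<Sum>i<N. coeff (\<pi> (f i)) (lead_deg I) * coeff (\<pi> (g i)) (lead_deg J))"
    using coeff_monomial_sum by blast
  then show "\<exists>(N::nat) v w. (\<forall>i<N. v i \<in> lead_forms I \<and> w i \<in> lead_forms J) \<and>
        monom 1 b = (\<Sum>i<N. v i * w i)"
    by (intro exI[of _ N] exI[of _ "\<lambda>i. coeff (\<pi> (f i)) (lead_deg I)"]
        exI[of _ "\<lambda>i. coeff (\<pi> (g i)) (lead_deg J)"]) (auto simp: lead_forms_def)
qed (auto intro: lead_forms_add lead_forms_smult lead_forms_coeff ideal_I ideal_J B_0)

text \<open>
  If the leading forms are constants, then $I$ contains an element $1 + X p + Y q$; since it also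
  contains powers of $X$ and $Y$, it is the unit ideal.
\<close>

lemma UNIV_if_constant_forms:
  assumes const: "\<forall>v\<in>lead_forms I. degree v = 0"
  shows "I = UNIV"
proof -
  \<comment> \<open>The left factors are constant in Y, so Y^m needs a right factor of degree at
    least m, while members of \<open>lead_forms J\<close> have degree at most
    \<open>lead_deg J\<close>. As the leading degrees add up to m, I has leading degree 0.\<close>
  have "m \<le> lead_deg J"
  proof -
    obtain N :: nat and v w where vw: "\<forall>i<N. v i \<in> lead_forms I \<and> w i \<in> lead_forms J"
      "monom 1 m = (\<Sum>i<N. v i * w i)"
      using monom_sum[OF B_m] by blast
    have "degree (v i * w i) \<le> lead_deg J" if "i < N" for i
      using degree_mult_le[of "v i" "w i"] const vw(1) that degree_lead_form[of "w i" J] by fastforce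
    then have "degree (\<Sum>i<N. v i * w i) \<le> lead_deg J" by (intro degree_sum_le) auto
    then show ?thesis by (simp add: degree_monom_eq flip: vw(2))
  qed
  then have s: "lead_deg I = 0" using lead_deg_sum by simp
  obtain N :: nat and f g where fg: "\<forall>i<N. f i \<in> I \<and> g i \<in> J"
    "monom 1 0 = (\<Sum>i<N. coeff (\<pi> (f i)) (lead_deg I) * coeff (\<pi> (g i)) (lead_deg J))"
    using coeff_monomial_sum[OF B_0] by blast
  have "\<forall>i. \<exists>r. \<pi> r = [:[:coeff (coeff (\<pi> (g i)) (lead_deg J)) 0:]:]"
    by (intro allI coeff_lift)
  from choice[OF this] obtain r where r: "\<pi> (r i) = [:[:coeff (coeff (\<pi> (g i)) (lead_deg J)) 0:]:]" for i
    by blast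
  \<comment> \<open>The r i lift the constant coefficients of the leading parts of the g i. Hence
    the part of degree 0 of \<open>?f\<close> is the constant coefficient of the sum for Y^0, that
    is, 1.\<close>
  let ?f = "\<Sum>i<N. r i * f i"
  have "?f \<in> I" using ideal_I fg(1) by (intro is_ideal_sum) (auto simp: is_ideal_def)
  have f0: "coeff (\<pi> (f i)) 0 = [:coeff (coeff (\<pi> (f i)) 0) 0:]" for i
    using degree_form[of "f i" 0] by (metis coeff_pCons_0 degree_eq_zeroE le_zero_eq)
  have "coeff (\<pi> ?f) 0 = (\<Sum>i<N. smult (coeff (coeff (\<pi> (g i)) (lead_deg J)) 0) (coeff (\<pi> (f i)) 0))"
    by (simp add: map_sum map_mult r coeff_sum coeff_mult_0)
  also have "\<dots> = (\<Sum>i<N. [:coeff (coeff (\<pi> (f i)) 0 * coeff (\<pi> (g i)) (lead_deg J)) 0:])"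
    by (subst f0) (simp add: coeff_mult_0 mult.commute)
  also have "\<dots> = [:coeff (monom 1 0) 0:]"
    unfolding fg(2) s by (rule poly_eqI) (simp add: coeff_sum coeff_pCons split: nat.split)
  finally have "coeff (\<pi> (?f - 1)) 0 = 0" by (simp add: map_diff map_one one_pCons)
  then obtain p q where "?f - 1 = X * p + Y * q" using form_0 by blast
  then have "1 + X * p + Y * q \<in> I" using \<open>?f \<in> I\<close> by (simp add: algebra_simps)
  moreover have "mono_ideal m B \<subseteq> I"
    unfolding factorization[symmetric] by (rule ideal_mult_subset_left[OF ideal_I])
  then have "X ^ m \<in> I" "Y ^ m \<in> I"
    using mono_ideal_mem[OF B_0, of m] mono_ideal_mem[OF B_m, of m] by auto
  ultimately show ?thesis using is_ideal_UNIV_if_unit_mod_nilpotent[OF ideal_I] by blast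
qed

lemma zero_in_lead_orders: "0 \<in> lead_orders I"
proof -
  obtain f where "f \<in> lead_forms I" "lowest f 0"
    using exists_lowest_0 unfolding lowest_0_iff by blast
  then show ?thesis unfolding lead_orders_def by blast
qed

lemma pos_in_lead_orders:
  assumes "I \<noteq> UNIV"
  shows "\<exists>e\<in>lead_orders I. 0 < e"
proof (rule ccontr)
  assume "\<not> ?thesis"
  then have "lead_orders I \<subseteq> {0}" by auto
  then have *: "e = 0" if "f \<in> lead_forms I" "lowest f e" for f e
    using that unfolding lead_orders_def by blast
  have "\<forall>v\<in>lead_forms I. degree v = 0"
    by (rule ballI, rule constant_if_lowest_0) (use * in auto)
  then show False using UNIV_if_constant_forms assms by blast
qed

end

context form_grading
begin

lemma ideal_atom_mono_idealI:
  assumes "B \<subseteq> {..m}" "0 \<in> B" "m \<in> B" "0 < m"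
    and const: "\<And>V W. submodule_product const_coeffs V W B \<Longrightarrow>
      (\<forall>f\<in>V. degree f = 0) \<or> (\<forall>g\<in>W. degree g = 0)"
  shows "ideal_atom (mono_ideal m B)"
  unfolding ideal_atom_def
proof (intro conjI allI impI)
  fix I J assume "nz_ideal I" "nz_ideal J" "mono_ideal m B = ideal_mult I J"
  then interpret F: mono_ideal_factorization \<pi> X Y m B I J
    by unfold_locales (use assms in \<open>auto simp: nz_ideal_def\<close>)
  interpret G: mono_ideal_factorization \<pi> X Y m B J I by (rule F.swap_factors)
  show "I = UNIV \<or> J = UNIV"
    using const[OF F.submodule_product_axioms] F.UNIV_if_constant_forms G.UNIV_if_constant_forms by blast
next
  show "nz_ideal (mono_ideal m B)" by (rule nz_mono_ideal[OF assms(2)])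
  show "mono_ideal m B \<noteq> UNIV" by (rule mono_ideal_proper[OF assms(1,4)])
qed

lemma ideal_atom_two:
  assumes "0 < e"
  shows "ideal_atom (mono_ideal e {0, e})"
  by (rule ideal_atom_mono_idealI)
    (use assms in \<open>auto dest!: submodule_product.constant_factor_two[OF _ refl]\<close>)

text \<open>Each factor offers order 0 and a positive order s i, and orders add up in products.
  Choosing s i for i in K and 0 elsewhere realizes the sum over K.\<close>

lemma ideal_lengths_subset_sums:
  assumes B: "B \<subseteq> {..m}" "0 \<in> B" "m \<in> B" and k: "k \<in> ideal_lengths (mono_ideal m B)"
  shows "\<exists>s. (\<forall>i<k. 0 < s i) \<and> (\<forall>K\<subseteq>{..<k}. (\<Sum>i\<in>K. s i) \<in> B)"
proof -
  obtain Js where Js: "length Js = k" "\<forall>A\<in>set Js. ideal_atom A" "ideal_prod Js = mono_ideal m B"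
    using k by (auto simp: ideal_lengths_def)
  have id: "is_ideal A" "A \<noteq> UNIV" if "A \<in> set Js" for A
    using Js(2) that by (auto simp: ideal_atom_def nz_ideal_def)
  \<comment> \<open>Each factor is paired with the product of all the others.\<close>
  have fac: "mono_ideal_factorization \<pi> X Y m B (Js ! i) (ideal_prod (take i Js @ drop (Suc i) Js))"
    if "i < k" for i
  proof -
    have sub: "set (take i Js @ drop (Suc i) Js) \<subseteq> set Js"
      using set_take_subset set_drop_subset by fastforce
    have eq: "Js = take i Js @ Js ! i # drop (Suc i) Js" using that Js(1) by (simp add: id_take_nth_drop)
    have "ideal_prod Js = ideal_mult (Js ! i) (ideal_prod (take i Js @ drop (Suc i) Js))"
      using ideal_prod_extract[of "take i Js" "Js ! i" "drop (Suc i) Js"] id eq by metis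
    moreover have "is_ideal (ideal_prod (take i Js @ drop (Suc i) Js))"
      by (rule is_ideal_ideal_prod, rule id(1)) (use sub in blast)
    moreover have "is_ideal (Js ! i)" using id(1) that Js(1) by simp
    ultimately show ?thesis
      using B Js(3) by unfold_locales simp_all
  qed
  have "\<forall>i<k. \<exists>e\<in>lead_orders (Js ! i). 0 < e"
    by (intro allI impI mono_ideal_factorization.pos_in_lead_orders[OF fac] id(2)) (simp_all add: Js(1))
  then obtain s where s: "\<And>i. i < k \<Longrightarrow> s i \<in> lead_orders (Js ! i) \<and> 0 < s i" by metis
  have "(\<Sum>i\<in>K. s i) \<in> B" if K: "K \<subseteq> {..<k}" for K
  proof -
    let ?es = "map (\<lambda>i. if i \<in> K then s i else 0) [0..<k]"
    have "list_all2 (\<lambda>J e. is_ideal J \<and> nontrivial J \<and> e \<in> lead_orders J) Js ?es"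
      unfolding list_all2_conv_all_nth
    proof (intro conjI allI impI)
      fix i assume "i < length Js"
      then have i: "i < k" using Js(1) by simp
      show "is_ideal (Js ! i)" using id(1) i Js(1) by simp
      show "nontrivial (Js ! i)" by (rule mono_ideal_factorization.nontrivial_I[OF fac[OF i]])
      show "?es ! i \<in> lead_orders (Js ! i)"
        using s[OF i] mono_ideal_factorization.zero_in_lead_orders[OF fac[OF i]] i by auto
    qed (simp add: Js(1))
    from lead_orders_ideal_prod[OF this] have "sum_list ?es \<in> lead_orders (mono_ideal m B)"
      unfolding Js(3) by (rule conjunct2)
    moreover have "sum_list ?es = (\<Sum>i\<in>{..<k}. if i \<in> K then s i else 0)"
      by (simp add: sum_list_distinct_conv_sum_set atLeast0LessThan)
    moreover have "(\<Sum>i\<in>{..<k}. if i \<in> K then s i else 0) = (\<Sum>i\<in>K. s i)"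
      using K by (simp add: sum.If_cases Int_absorb1)
    ultimately show ?thesis using subsetD[OF lead_orders_mono_ideal[OF B(1)]] by simp
  qed
  then show ?thesis using s by blast
qed

end

section \<open>Subset sums\<close>

text \<open>A_n for j = n - 1 and C_n for j = n + 1, in a form that admits induction on j.\<close>

definition subset_sums :: "(nat \<Rightarrow> nat) \<Rightarrow> nat \<Rightarrow> nat set" where
  "subset_sums a j = (\<lambda>I. \<Sum>i\<in>I. a i) ` Pow {1..j}"

lemma subset_sums_0: "subset_sums a 0 = {0}"
  by (simp add: subset_sums_def)

lemma subset_sums_Suc:
  "subset_sums a (Suc j) = subset_sums a j \<union> (\<lambda>t. t + a (Suc j)) ` subset_sums a j"
proof -
  have "(\<Sum>i\<in>insert (Suc j) I. a i) = (\<Sum>i\<in>I. a i) + a (Suc j)" if "I \<in> Pow {1..j}" for I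
  proof -
    have "finite I" "Suc j \<notin> I" using that finite_subset by auto
    then show ?thesis by simp
  qed
  then have "(\<lambda>I. \<Sum>i\<in>I. a i) ` insert (Suc j) ` Pow {1..j} = (\<lambda>t. t + a (Suc j)) ` subset_sums a j"
    unfolding subset_sums_def image_image by (intro image_cong) auto
  then show ?thesis
    by (simp add: subset_sums_def atLeastAtMostSuc_conv Pow_insert image_Un)
qed

lemma subset_sums_le: "t \<in> subset_sums a j \<Longrightarrow> t \<le> (\<Sum>i\<in>{1..j}. a i)"
  by (auto simp: subset_sums_def intro!: sum_mono2)

lemma sum_in_subset_sums: "(\<Sum>i\<in>{1..j}. a i) \<in> subset_sums a j"
  by (auto simp: subset_sums_def)

lemma zero_in_subset_sums: "0 \<in> subset_sums a j"
  by (auto simp: subset_sums_def intro!: image_eqI[of _ _ "{}"])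

text \<open>Numbers are added one at a time. Each is at most M, so the partial sums, all in C,
  cannot jump over the gap (M, 2 M].\<close>

lemma sum_le_if_gap:
  assumes "finite L" "\<And>t. t \<in> C \<Longrightarrow> t \<le> M \<or> 2 * M < t"
    "\<And>i. i \<in> L \<Longrightarrow> s i \<le> M" "\<And>L'. L' \<subseteq> L \<Longrightarrow> (\<Sum>i\<in>L'. s i) \<in> (C :: nat set)"
  shows "(\<Sum>i\<in>L. s i) \<le> M"
  using assms
proof (induction L rule: finite_induct)
  case (insert k L)
  have "(\<Sum>i\<in>L. s i) \<le> M"
    by (rule insert.IH[OF insert.prems(1) insert.prems(2) insert.prems(3)]) auto
  then have "(\<Sum>i\<in>insert k L. s i) \<le> 2 * M"
    using insert.prems(2)[of k] insert.hyps by simp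
  moreover have "(\<Sum>i\<in>insert k L. s i) \<in> C" by (rule insert.prems(3)) simp
  ultimately show ?case using insert.prems(1) by (meson linorder_not_le)
qed simp

text \<open>If e is a sum of the first j terms, then 2 e < \<open>a (Suc j)\<close> and induction
  applies; otherwise e is at least \<open>a (Suc j)\<close>, and 2 e exceeds the sum of all
  terms.\<close>

lemma no_double_subset_sums:
  assumes "\<forall>i<j. 2 * (\<Sum>l\<in>{1..i}. a l) < a (Suc i)" "e \<in> subset_sums a j" "0 < e"
  shows "2 * e \<notin> subset_sums a j"
  using assms
proof (induction j)
  case 0
  then show ?case by (simp add: subset_sums_0)
next
  case (Suc j)
  let ?M = "\<Sum>l\<in>{1..j}. a l"
  have A: "2 * ?M < a (Suc j)" using Suc.prems(1) by blast
  show ?case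
  proof (cases "e \<in> subset_sums a j")
    case True
    then have "2 * e \<notin> subset_sums a j" using Suc.IH Suc.prems by simp
    moreover have "2 * e < a (Suc j)" using subset_sums_le[OF True] A by linarith
    ultimately show ?thesis by (auto simp: subset_sums_Suc)
  next
    case False
    then have "a (Suc j) \<le> e" using Suc.prems(2) by (auto simp: subset_sums_Suc)
    then have "?M + a (Suc j) < 2 * e" using A by linarith
    then show ?thesis using subset_sums_le[of "2 * e" a "Suc j"] by (auto simp: atLeastAtMostSuc_conv)
  qed
qed

text \<open>A number of size at least \<open>a (Suc j)\<close> leaves at most M for all others
  together, so removing it lowers j by one. If there is none, every number is at most M, and the gap
  (M, 2 M] confines all sums to the subset sums of the first j terms.\<close>

lemma card_le_subset_sums:
  assumes "\<forall>i<j. 2 * (\<Sum>l\<in>{1..i}. a l) < a (Suc i)" "finite K"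
    "\<And>k. k \<in> K \<Longrightarrow> 0 < s k" "\<And>L. L \<subseteq> K \<Longrightarrow> (\<Sum>i\<in>L. s i) \<in> subset_sums a j"
  shows "card K \<le> j"
  using assms
proof (induction j arbitrary: K)
  case 0
  have "K = {}"
  proof (rule ccontr)
    assume "K \<noteq> {}"
    then obtain k where "k \<in> K" by blast
    then show False using "0.prems"(3)[of k] "0.prems"(4)[of "{k}"] by (simp add: subset_sums_0)
  qed
  then show ?case by simp
next
  case (Suc j)
  let ?M = "\<Sum>l\<in>{1..j}. a l"
  have A: "2 * ?M < a (Suc j)" using Suc.prems(1) by blast
  have le: "t \<le> ?M + a (Suc j)" if "t \<in> subset_sums a (Suc j)" for t
    using subset_sums_le[OF that] by (simp add: atLeastAtMostSuc_conv)
  have low: "t \<in> subset_sums a j" if "t \<in> subset_sums a (Suc j)" "t < a (Suc j)" for t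
    using that by (auto simp: subset_sums_Suc)
  have IH: "card K' \<le> j" if "K' \<subseteq> K" "\<And>L. L \<subseteq> K' \<Longrightarrow> (\<Sum>i\<in>L. s i) \<in> subset_sums a j" for K'
    by (rule Suc.IH) (use Suc.prems that in \<open>auto intro: finite_subset\<close>)
  show ?case
  proof (cases "\<exists>k\<in>K. a (Suc j) \<le> s k")
    case True
    then obtain k where k: "k \<in> K" "a (Suc j) \<le> s k" by blast
    have "(\<Sum>i\<in>L. s i) \<in> subset_sums a j" if L: "L \<subseteq> K - {k}" for L
    proof (rule low)
      have "finite L" "k \<notin> L" using L Suc.prems(2) finite_subset by auto
      then have "s k + (\<Sum>i\<in>L. s i) = (\<Sum>i\<in>insert k L. s i)" by simp
      also have "\<dots> \<le> ?M + a (Suc j)" by (rule le, rule Suc.prems(4)) (use L k in auto)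
      finally show "(\<Sum>i\<in>L. s i) < a (Suc j)" using k(2) A by linarith
      show "(\<Sum>i\<in>L. s i) \<in> subset_sums a (Suc j)" using L by (intro Suc.prems(4)) auto
    qed
    then have "card (K - {k}) \<le> j" by (intro IH) auto
    then show ?thesis using k(1) Suc.prems(2) by (simp add: card_Diff_singleton)
  next
    case False
    have s: "s k \<le> ?M" if "k \<in> K" for k
    proof -
      have "s k \<in> subset_sums a j"
        using low[of "s k"] Suc.prems(4)[of "{k}"] that False by (simp add: not_le)
      then show ?thesis by (rule subset_sums_le)
    qed
    have "(\<Sum>i\<in>L. s i) \<in> subset_sums a j" if L: "L \<subseteq> K" for L
    proof (rule low)
      show "(\<Sum>i\<in>L. s i) \<in> subset_sums a (Suc j)" by (rule Suc.prems(4)[OF L])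
      have "(\<Sum>i\<in>L. s i) \<le> ?M"
      proof (rule sum_le_if_gap[where C = "subset_sums a (Suc j)"])
        show "finite L" using L Suc.prems(2) by (rule finite_subset)
        show "t \<le> ?M \<or> 2 * ?M < t" if "t \<in> subset_sums a (Suc j)" for t
          using that subset_sums_le[of _ a j] A by (auto simp: subset_sums_Suc)
      qed (use L s Suc.prems(4) in auto)
      then show "(\<Sum>i\<in>L. s i) < a (Suc j)" using A by linarith
    qed
    then have "card K \<le> j" by (intro IH) auto
    then show ?thesis by simp
  qed
qed

section \<open>Sequences satisfying (C1) and (C2)\<close>

locale C1_C2_sequence =
  fixes a :: "nat \<Rightarrow> nat" and n :: nat
  assumes n2: "2 \<le> n"
    and apos: "\<forall>i\<in>{1..n+1}. a i > 0"
    and C1: "a (n+1) = (\<Sum>i\<in>{1..n-1}. a i) + 2 * a n"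
    and C2: "\<forall>i\<in>{1..n-1}. a (i+1) > 2 * (\<Sum>j\<in>{1..i}. a j)"
begin

definition \<alpha> :: nat where "\<alpha> = (\<Sum>i\<in>{1..n-1}. a i)"

abbreviation c :: nat where "c \<equiv> \<alpha> + a n"

lemma superincreasing: "\<forall>i<n. 2 * (\<Sum>l\<in>{1..i}. a l) < a (Suc i)"
proof (intro allI impI)
  fix i assume "i < n"
  then show "2 * (\<Sum>l\<in>{1..i}. a l) < a (Suc i)"
    using C2 apos by (cases "i = 0") auto
qed

lemma two_alpha_less: "2 * \<alpha> < a n"
  using superincreasing[rule_format, of "n - 1"] n2 by (simp add: \<alpha>_def)

lemma alpha_pos: "0 < \<alpha>"
  unfolding \<alpha>_def using apos n2 by (intro sum_pos) auto

lemma a_Suc_n: "a (Suc n) = \<alpha> + 2 * a n"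
  using C1 by (simp add: \<alpha>_def)

lemma subset_sums_n: "subset_sums a n = subset_sums a (n-1) \<union> (\<lambda>t. t + a n) ` subset_sums a (n-1)"
  using subset_sums_Suc[of a "n - 1"] n2 by simp

lemma sum_n: "(\<Sum>i\<in>{1..n}. a i) = c"
proof -
  have "{1..n} = insert n {1..n-1}" using n2 by auto
  then show ?thesis using n2 by (simp add: \<alpha>_def)
qed

lemma sum_Suc_n: "(\<Sum>i\<in>{1..Suc n}. a i) = 2 * c + a n"
  using sum_n a_Suc_n by (simp add: atLeastAtMostSuc_conv)

lemma subset_sums_le_alpha: "t \<in> subset_sums a (n-1) \<Longrightarrow> t \<le> \<alpha>"
  unfolding \<alpha>_def by (rule subset_sums_le)

text \<open>\<open>card_le_subset_sums\<close> reaches only j = n, because \<open>a (Suc n)\<close>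
  is below 2 c. A number of size at least \<open>a (Suc n)\<close> is removed as there. Without one,
  at most n - 1 numbers are small (at most \<alpha>) and at most 3 are big (at least
  \<open>a n\<close>), so only the case of three big numbers needs more work.\<close>

lemma card_le_Suc_n:
  assumes K: "finite K" and pos: "\<And>k. k \<in> K \<Longrightarrow> 0 < s k"
    and sums: "\<And>L. L \<subseteq> K \<Longrightarrow> (\<Sum>i\<in>L. s i) \<in> subset_sums a (Suc n)"
  shows "card K \<le> n + 1"
proof -
  have le: "t \<le> 2 * c + a n" if "t \<in> subset_sums a (Suc n)" for t
    using subset_sums_le[OF that] by (simp only: sum_Suc_n)
  have le_n: "t \<le> c" if "t \<in> subset_sums a n" for t
    using subset_sums_le[OF that] by (simp only: sum_n)
  have low: "t \<in> subset_sums a n" if "t \<in> subset_sums a (Suc n)" "t < a (Suc n)" for t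
    using that by (auto simp: subset_sums_Suc)
  have low': "t \<in> subset_sums a (n-1)" if "t \<in> subset_sums a (Suc n)" "t < a n" for t
    using low[OF that(1)] that(2) a_Suc_n by (auto simp: subset_sums_n)
  show ?thesis
  proof (cases "\<exists>k\<in>K. a (Suc n) \<le> s k")
    case True
    then obtain k where k: "k \<in> K" "a (Suc n) \<le> s k" by blast
    have "(\<Sum>i\<in>L. s i) \<in> subset_sums a n" if L: "L \<subseteq> K - {k}" for L
    proof (rule low)
      have "finite L" "k \<notin> L" using L K finite_subset by auto
      then have "s k + (\<Sum>i\<in>L. s i) = (\<Sum>i\<in>insert k L. s i)" by simp
      also have "\<dots> \<le> 2 * c + a n" by (rule le, rule sums) (use L k in auto)
      finally show "(\<Sum>i\<in>L. s i) < a (Suc n)" using k(2) a_Suc_n two_alpha_less by simp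
      show "(\<Sum>i\<in>L. s i) \<in> subset_sums a (Suc n)" using L by (intro sums) auto
    qed
    then have "card (K - {k}) \<le> n"
      by (intro card_le_subset_sums[OF superincreasing, of _ s]) (use K pos in auto)
    then show ?thesis using k(1) K by (simp add: card_Diff_singleton)
  next
    case False
    have s_n: "s k \<in> subset_sums a n" if "k \<in> K" for k
      using low[of "s k"] sums[of "{k}"] that False by (simp add: not_le)
    define Kb where "Kb = {k\<in>K. a n \<le> s k}"
    define Ks where "Ks = K - Kb"
    have fin: "finite Kb" "finite Ks" and sub: "Kb \<subseteq> K" "Ks \<subseteq> K" using K by (auto simp: Kb_def Ks_def)
    have card_K: "card K = card Kb + card Ks"
      unfolding Ks_def using K sub card_Diff_subset[of Kb K] card_mono[of K Kb] fin by simp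
    have small: "s k \<le> \<alpha>" if "k \<in> Ks" for k
      using s_n[of k] that subset_sums_le_alpha by (auto simp: Ks_def Kb_def subset_sums_n)
    have small_sum: "(\<Sum>i\<in>L. s i) \<le> \<alpha>" if L: "L \<subseteq> Ks" for L
    proof (rule sum_le_if_gap[where C = "subset_sums a (Suc n)"])
      show "finite L" using L fin(2) by (rule finite_subset)
      show "t \<le> \<alpha> \<or> 2 * \<alpha> < t" if "t \<in> subset_sums a (Suc n)" for t
        using low'[OF that] subset_sums_le_alpha two_alpha_less by (cases "t < a n") auto
    qed (use L small sums sub in auto)
    have small_in: "(\<Sum>i\<in>L. s i) \<in> subset_sums a (n-1)" if L: "L \<subseteq> Ks" for L
      using low'[of "\<Sum>i\<in>L. s i"] sums[of L] small_sum[OF L] L sub two_alpha_less alpha_pos by auto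
    have super': "\<forall>i<n-1. 2 * (\<Sum>l\<in>{1..i}. a l) < a (Suc i)" using superincreasing by simp
    have card_Ks: "card Ks \<le> n - 1"
      by (rule card_le_subset_sums[OF super', of _ s]) (use fin sub pos small_in in auto)
    \<comment> \<open>Four big numbers would exceed the total 2 \<alpha> + 3 a_n, as 2 \<alpha> <
      a_n.\<close>
    have "card Kb * a n \<le> (\<Sum>i\<in>Kb. s i)"
      using sum_bounded_below[of Kb "a n" s] by (simp add: Kb_def)
    also have "\<dots> \<le> 2 * c + a n" by (rule le, rule sums, rule sub)
    also have "\<dots> < 4 * a n" using two_alpha_less by simp
    finally have "card Kb < 4" by simp
    show ?thesis
    proof (cases "card Kb = 3")
      case False
      then show ?thesis using \<open>card Kb < 4\<close> card_K card_Ks n2 by linarith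
    next
      case True
      \<comment> \<open>Two copies of a_n are impossible: 2 a_n lies strictly between c and a_(n+1),
        where there is no subset sum.\<close>
      have "\<exists>k\<in>Kb. s k \<noteq> a n"
      proof (rule ccontr)
        assume all: "\<not> ?thesis"
        obtain T where T: "T \<subseteq> Kb" "card T = 2"
          using obtain_subset_with_card_n[of 2 Kb] True by auto
        have "(\<Sum>i\<in>T. s i) = (\<Sum>i\<in>T. a n)" using all T by (intro sum.cong) auto
        then have "2 * a n \<in> subset_sums a (Suc n)" using sums[of T] T sub by simp
        then have "2 * a n \<le> c" using low le_n a_Suc_n alpha_pos by auto
        then show False using two_alpha_less by linarith
      qed
      then obtain k where k: "k \<in> Kb" "s k \<noteq> a n" by blast
      then have sk: "k \<in> K" "a n < s k" "k \<notin> Ks" by (auto simp: Kb_def Ks_def)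
      \<comment> \<open>Lowered by a_n, the big number k joins the small ones: a sum involving it is
        a subset sum of a_1, ..., a_n above \<alpha>, so it uses a_n, and dropping a_n leaves an
        element of A_n. Thus n - 1 bounds \<open>card Ks + 1\<close>, which makes room for the third
        big number.\<close>
      let ?s = "s(k := s k - a n)"
      have "card (insert k Ks) \<le> n - 1"
      proof (rule card_le_subset_sums[OF super', of _ ?s])
        show "finite (insert k Ks)" using fin by simp
        show "0 < ?s i" if "i \<in> insert k Ks" for i using that sk pos sub by auto
        show "(\<Sum>i\<in>L. ?s i) \<in> subset_sums a (n-1)" if L: "L \<subseteq> insert k Ks" for L
        proof (cases "k \<in> L")
          case False
          then have "L \<subseteq> Ks" using L by auto
          moreover have "(\<Sum>i\<in>L. ?s i) = (\<Sum>i\<in>L. s i)" using False by (intro sum.cong) auto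
          ultimately show ?thesis using small_in by simp
        next
          case True
          let ?L = "L - {k}"
          have finL: "finite L" using L fin by (meson finite_insert finite_subset)
          have L': "?L \<subseteq> Ks" using L by auto
          have "(\<Sum>i\<in>?L. ?s i) = (\<Sum>i\<in>?L. s i)" by (intro sum.cong) auto
          then have eq: "(\<Sum>i\<in>L. ?s i) + a n = (\<Sum>i\<in>L. s i)"
            using sum.remove[OF finL True, of s] sum.remove[OF finL True, of ?s] sk(2) by simp
          have "(\<Sum>i\<in>L. s i) \<in> subset_sums a (Suc n)"
            by (rule sums) (use L sub sk in auto)
          moreover have "(\<Sum>i\<in>L. s i) < a (Suc n)"
            using sum.remove[OF finL True, of s] small_sum[OF L'] le_n[OF s_n[OF sk(1)]]
              two_alpha_less a_Suc_n by linarith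
          ultimately have "(\<Sum>i\<in>L. ?s i) + a n \<in> subset_sums a n" unfolding eq by (rule low)
          moreover have "(\<Sum>i\<in>L. ?s i) + a n \<notin> subset_sums a (n-1)"
            using subset_sums_le_alpha[of "(\<Sum>i\<in>L. ?s i) + a n"] two_alpha_less alpha_pos by linarith
          ultimately show ?thesis by (auto simp: subset_sums_n)
        qed
      qed
      then show ?thesis using True card_K fin sk(3) n2 by simp
    qed
  qed
qed

end

section \<open>The polynomial ring\<close>

text \<open>
  The substitution sends $x$ to $T$, $y$ to $T Y$ and every other variable to a variable of the
  coefficient ring, so the coefficient of $T^d$ is the dehomogenized part of degree $d$ in $x, y$.
  The other variables are renumbered by $\iota$ because polynomial mappings are an instance
  of idom only for linearly ordered exponents.
\<close>

locale two_variables =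
  fixes x y :: "'v::finite" and \<iota> :: "'v \<Rightarrow> nat" and coeff_type :: "'a::idom itself"
  assumes xy: "x \<noteq> y" and inj_\<iota>: "inj \<iota>"
begin

definition rest :: "('v \<Rightarrow>\<^sub>0 nat) \<Rightarrow> (nat \<Rightarrow>\<^sub>0 nat)" where
  "rest \<mu> = (\<Sum>v\<in>UNIV - {x, y}. Poly_Mapping.single (\<iota> v) (Poly_Mapping.lookup \<mu> v))"

text \<open>Supplies the lifts for \<open>coeff_lift\<close>: the other exponents are kept inside
  the original ring.\<close>

definition strip :: "('v \<Rightarrow>\<^sub>0 nat) \<Rightarrow> ('v \<Rightarrow>\<^sub>0 nat)" where
  "strip \<mu> = (\<Sum>v\<in>UNIV - {x, y}. Poly_Mapping.single v (Poly_Mapping.lookup \<mu> v))"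

definition form_term :: "('v \<Rightarrow>\<^sub>0 nat) \<Rightarrow> 'a \<Rightarrow> ((nat \<Rightarrow>\<^sub>0 nat) \<Rightarrow>\<^sub>0 'a) poly poly" where
  "form_term \<mu> k = monom (monom (Poly_Mapping.single (rest \<mu>) k) (Poly_Mapping.lookup \<mu> y)) (Poly_Mapping.lookup \<mu> x + Poly_Mapping.lookup \<mu> y)"

definition form_map :: "('v, 'a) mpoly \<Rightarrow> ((nat \<Rightarrow>\<^sub>0 nat) \<Rightarrow>\<^sub>0 'a) poly poly" where
  "form_map f = (\<Sum>\<mu>\<in>Poly_Mapping.keys f. form_term \<mu> (Poly_Mapping.lookup f \<mu>))"

lemma lookup_rest: "v \<notin> {x, y} \<Longrightarrow> Poly_Mapping.lookup (rest \<mu>) (\<iota> v) = Poly_Mapping.lookup \<mu> v"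
proof -
  assume v: "v \<notin> {x, y}"
  have "Poly_Mapping.lookup (rest \<mu>) (\<iota> v) = (\<Sum>w\<in>UNIV - {x, y}. if w = v then Poly_Mapping.lookup \<mu> w else 0)"
    unfolding rest_def lookup_sum by (rule sum.cong) (auto simp: lookup_single when_def inj_eq[OF inj_\<iota>])
  then show ?thesis using v by simp
qed

lemma lookup_strip: "Poly_Mapping.lookup (strip \<mu>) v = (if v \<in> {x, y} then 0 else Poly_Mapping.lookup \<mu> v)"
proof -
  have "Poly_Mapping.lookup (strip \<mu>) v = (\<Sum>w\<in>UNIV - {x, y}. if w = v then Poly_Mapping.lookup \<mu> w else 0)"
    unfolding strip_def lookup_sum by (rule sum.cong) (auto simp: lookup_single when_def)
  then show ?thesis by auto
qed

lemma rest_add: "rest (\<mu> + \<nu>) = rest \<mu> + rest \<nu>"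
  by (simp add: rest_def lookup_add single_add sum.distrib)

lemma rest_strip: "rest (strip \<mu>) = rest \<mu>"
  unfolding rest_def by (rule sum.cong) (auto simp: lookup_strip)

lemma rest_single:
  assumes "v \<in> {x, y}"
  shows "rest (Poly_Mapping.single v i) = 0"
  unfolding rest_def using assms by (intro sum.neutral) (auto simp: lookup_single when_def)

lemma rest_inject:
  assumes "rest \<mu> = rest \<nu>" "Poly_Mapping.lookup \<mu> x = Poly_Mapping.lookup \<nu> x" "Poly_Mapping.lookup \<mu> y = Poly_Mapping.lookup \<nu> y"
  shows "\<mu> = \<nu>"
proof (rule poly_mapping_eqI)
  fix v
  show "Poly_Mapping.lookup \<mu> v = Poly_Mapping.lookup \<nu> v"
    using assms lookup_rest[of v \<mu>] lookup_rest[of v \<nu>] by (cases "v \<in> {x, y}") auto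
qed

lemma form_term_0: "form_term \<mu> 0 = 0"
  by (simp add: form_term_def)

lemma form_term_add: "form_term \<mu> (k + l) = form_term \<mu> k + form_term \<mu> l"
  by (simp add: form_term_def single_add add_monom)

lemma form_term_mult: "form_term (\<mu> + \<nu>) (k * l) = form_term \<mu> k * form_term \<nu> l"
  by (simp add: form_term_def rest_add lookup_add mult_monom mult_single ac_simps)

lemma coeff_form_term:
  "coeff (form_term \<mu> k) d = (if Poly_Mapping.lookup \<mu> x + Poly_Mapping.lookup \<mu> y = d then monom (Poly_Mapping.single (rest \<mu>) k) (Poly_Mapping.lookup \<mu> y) else 0)"
  by (simp add: form_term_def)

lemma form_map_add: "form_map (f + g) = form_map f + form_map g"
  unfolding form_map_def by (rule setsum_keys_plus_distrib) (simp_all add: form_term_0 form_term_add)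

lemma form_map_single: "form_map (Poly_Mapping.single \<mu> k) = form_term \<mu> k"
  by (simp add: form_map_def form_term_0)

lemma form_map_sum: "form_map (\<Sum>i\<in>T. h i) = (\<Sum>i\<in>T. form_map (h i))"
  by (induction T rule: infinite_finite_induct) (simp_all add: form_map_add, simp_all add: form_map_def)

lemma sum_single_keys: "f = (\<Sum>\<mu>\<in>Poly_Mapping.keys f. Poly_Mapping.single \<mu> (Poly_Mapping.lookup f \<mu>))"
  by (rule poly_mapping_eqI) (auto simp: lookup_sum lookup_single when_def in_keys_iff)

lemma form_map_mult: "form_map (f * g) = form_map f * form_map g"
proof -
  have "f * g = (\<Sum>\<mu>\<in>Poly_Mapping.keys f. \<Sum>\<nu>\<in>Poly_Mapping.keys g. Poly_Mapping.single (\<mu> + \<nu>) (Poly_Mapping.lookup f \<mu> * Poly_Mapping.lookup g \<nu>))"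
    by (subst sum_single_keys[of f], subst sum_single_keys[of g]) (simp add: sum_product mult_single)
  then have "form_map (f * g) = (\<Sum>\<mu>\<in>Poly_Mapping.keys f. \<Sum>\<nu>\<in>Poly_Mapping.keys g. form_term (\<mu> + \<nu>) (Poly_Mapping.lookup f \<mu> * Poly_Mapping.lookup g \<nu>))"
    by (simp add: form_map_sum form_map_single)
  also have "\<dots> = form_map f * form_map g"
    by (simp add: form_term_mult form_map_def sum_product)
  finally show ?thesis .
qed

lemma coeff_coeff_form_map:
  "coeff (coeff (form_map f) d) j = (\<Sum>\<mu>\<in>Poly_Mapping.keys f.
    if Poly_Mapping.lookup \<mu> x + Poly_Mapping.lookup \<mu> y = d \<and> Poly_Mapping.lookup \<mu> y = j then Poly_Mapping.single (rest \<mu>) (Poly_Mapping.lookup f \<mu>) else 0)"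
  unfolding form_map_def coeff_sum by (rule sum.cong) (auto simp: coeff_form_term)

text \<open>Monomials free of x and y have distinct images under \<open>rest\<close>, so nothing
  cancels in the coefficient of T^0.\<close>

lemma keys_form_0:
  assumes "coeff (form_map f) 0 = 0" "\<mu> \<in> Poly_Mapping.keys f"
  shows "0 < Poly_Mapping.lookup \<mu> x \<or> 0 < Poly_Mapping.lookup \<mu> y"
proof (rule ccontr)
  assume "\<not> ?thesis"
  then have \<mu>: "Poly_Mapping.lookup \<mu> x = 0" "Poly_Mapping.lookup \<mu> y = 0" by auto
  have "0 = Poly_Mapping.lookup (coeff (coeff (form_map f) 0) 0) (rest \<mu>)" using assms(1) by simp
  also have "\<dots> = (\<Sum>\<nu>\<in>Poly_Mapping.keys f. if \<nu> = \<mu> then Poly_Mapping.lookup f \<nu> else 0)"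
    unfolding coeff_coeff_form_map lookup_sum
  proof (rule sum.cong)
    fix \<nu>
    show "Poly_Mapping.lookup (if Poly_Mapping.lookup \<nu> x + Poly_Mapping.lookup \<nu> y = 0 \<and> Poly_Mapping.lookup \<nu> y = 0 then Poly_Mapping.single (rest \<nu>) (Poly_Mapping.lookup f \<nu>) else 0) (rest \<mu>)
      = (if \<nu> = \<mu> then Poly_Mapping.lookup f \<nu> else 0)"
      using rest_inject[of \<nu> \<mu>] \<mu> by (auto simp: lookup_single when_def)
  qed simp
  also have "\<dots> = Poly_Mapping.lookup f \<mu>" using assms(2) by simp
  finally show False using assms(2) by (simp add: in_keys_iff)
qed

lemma single_dvd:
  assumes "0 < Poly_Mapping.lookup \<mu> v"
  shows "Poly_Mapping.single (Poly_Mapping.single v 1) 1 dvd (Poly_Mapping.single \<mu> k :: ('v, 'a) mpoly)"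
proof -
  have "\<mu> = Poly_Mapping.single v 1 + (\<mu> - Poly_Mapping.single v 1)"
    using assms by (intro poly_mapping_eqI) (auto simp: lookup_add lookup_minus lookup_single when_def)
  then have "Poly_Mapping.single \<mu> k = Poly_Mapping.single (Poly_Mapping.single v 1) 1 * Poly_Mapping.single (\<mu> - Poly_Mapping.single v 1) k"
    by (simp add: mult_single)
  then show ?thesis by (rule dvdI)
qed

text \<open>Links the monomials of the theorem to the powers in \<open>mono_ideal\<close>.\<close>

lemma monoXY_power: "monoXY x y i j = (monoXY x y 1 0 ^ i * monoXY x y 0 1 ^ j :: ('v, 'a) mpoly)"
proof -
  have "Poly_Mapping.single (Poly_Mapping.single v 1) 1 ^ i = (Poly_Mapping.single (Poly_Mapping.single v i) 1 :: ('v, 'a) mpoly)" for v :: 'v and i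
    by (induction i) (simp_all add: mult_single flip: single_add)
  then show ?thesis by (simp add: monoXY_def mult_single)
qed

sublocale form_grading form_map "monoXY x y 1 0" "monoXY x y 0 1"
proof
  fix f g :: "('v, 'a) mpoly" and d j :: nat
  show "form_map (f + g) = form_map f + form_map g" by (rule form_map_add)
  show "form_map (f * g) = form_map f * form_map g" by (rule form_map_mult)
  show "form_map (monoXY x y 1 0) = monom 1 1"
    using xy by (simp add: monoXY_def form_map_single form_term_def rest_single lookup_single when_def)
  show "form_map (monoXY x y 0 1) = monom (monom 1 1) 1"
    using xy by (simp add: monoXY_def form_map_single form_term_def rest_single lookup_single when_def)
  show "degree (coeff (form_map f) d) \<le> d"
    unfolding form_map_def coeff_sum
    by (rule degree_sum_le) (auto simp: coeff_form_term intro: order_trans[OF degree_monom_le])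
  show "\<exists>r. form_map r = [:[:coeff (coeff (form_map f) d) j:]:]"
  proof
    let ?P = "\<lambda>\<mu>. Poly_Mapping.lookup \<mu> x + Poly_Mapping.lookup \<mu> y = d \<and> Poly_Mapping.lookup \<mu> y = j"
    \<comment> \<open>The monomials of f that contribute to T^d Y^j, with x and y erased, so that
      the image is constant in T and Y.\<close>
    let ?r = "\<Sum>\<mu>\<in>Poly_Mapping.keys f. if ?P \<mu> then Poly_Mapping.single (strip \<mu>) (Poly_Mapping.lookup f \<mu>) else 0"
    have "form_map ?r = (\<Sum>\<mu>\<in>Poly_Mapping.keys f. [:[:if ?P \<mu> then Poly_Mapping.single (rest \<mu>) (Poly_Mapping.lookup f \<mu>) else 0:]:])"
      unfolding form_map_sum
    proof (rule sum.cong)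
      fix \<mu>
      have "form_map 0 = 0" by (simp add: form_map_def)
      then show "form_map (if ?P \<mu> then Poly_Mapping.single (strip \<mu>) (Poly_Mapping.lookup f \<mu>) else 0)
        = [:[:if ?P \<mu> then Poly_Mapping.single (rest \<mu>) (Poly_Mapping.lookup f \<mu>) else 0:]:]"
        by (simp add: form_map_single form_term_def rest_strip lookup_strip monom_0)
    qed simp
    also have "\<dots> = [:[:coeff (coeff (form_map f) d) j:]:]"
      unfolding coeff_coeff_form_map
      by (rule poly_eqI, rule poly_eqI) (auto simp: coeff_sum coeff_pCons split: nat.split)
    finally show "form_map ?r = [:[:coeff (coeff (form_map f) d) j:]:]" .
  qed
  show "\<exists>p q. f = monoXY x y 1 0 * p + monoXY x y 0 1 * q" if "coeff (form_map f) 0 = 0"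
  proof -
    let ?I = "{monoXY x y 1 0 * p + monoXY x y 0 1 * q | p q. True} :: ('v, 'a) mpoly set"
    have "Poly_Mapping.single \<mu> k \<in> ?I" if "0 < Poly_Mapping.lookup \<mu> x \<or> 0 < Poly_Mapping.lookup \<mu> y" for \<mu> k
    proof -
      have "monoXY x y 1 0 dvd (Poly_Mapping.single \<mu> k :: ('v, 'a) mpoly) \<or> monoXY x y 0 1 dvd (Poly_Mapping.single \<mu> k :: ('v, 'a) mpoly)"
        using that single_dvd[of \<mu> x k] single_dvd[of \<mu> y k] by (auto simp: monoXY_def)
      then show ?thesis
      proof
        assume "monoXY x y 1 0 dvd (Poly_Mapping.single \<mu> k :: ('v, 'a) mpoly)"
        then obtain p where "Poly_Mapping.single \<mu> k = monoXY x y 1 0 * p + monoXY x y 0 1 * 0" by auto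
        then show ?thesis by blast
      next
        assume "monoXY x y 0 1 dvd (Poly_Mapping.single \<mu> k :: ('v, 'a) mpoly)"
        then obtain q where "Poly_Mapping.single \<mu> k = monoXY x y 1 0 * 0 + monoXY x y 0 1 * q" by auto
        then show ?thesis by blast
      qed
    qed
    then have "(\<Sum>\<mu>\<in>Poly_Mapping.keys f. Poly_Mapping.single \<mu> (Poly_Mapping.lookup f \<mu>)) \<in> ?I"
      using keys_form_0[OF \<open>coeff (form_map f) 0 = 0\<close>]
      by (intro is_ideal_sum[OF is_ideal_two_generators]) blast
    then show ?thesis unfolding sum_single_keys[of f, symmetric] by blast
  qed
qed

end

section \<open>Factorizations of the monomial ideals\<close>

context C1_C2_sequence
begin

lemma setB_eq: "setB a n = subset_sums a (n-1) \<union> {c} \<union> (\<lambda>t. t + (\<alpha> + 2 * a n)) ` subset_sums a (n-1)"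
  unfolding setB_def setA_def subset_sums_def[symmetric] sum_n using a_Suc_n by simp

lemma setC_eq: "setC a n = subset_sums a (Suc n)"
  by (simp add: setC_def subset_sums_def)

lemma alpha_in: "\<alpha> \<in> subset_sums a (n-1)"
  unfolding \<alpha>_def by (rule sum_in_subset_sums)

lemma setB_le: "b \<in> setB a n \<Longrightarrow> b \<le> 2 * c"
  using subset_sums_le_alpha by (fastforce simp: setB_eq)

lemma zero_in_setB: "0 \<in> setB a n"
  by (simp add: setB_eq zero_in_subset_sums)

text \<open>By (C1) the largest element \<alpha> + a_(n+1) equals 2 c, so the middle element lies
  exactly halfway.\<close>

lemma two_c_in_setB: "2 * c \<in> setB a n"
proof -
  have "2 * c = \<alpha> + (\<alpha> + 2 * a n)" by simp
  then show ?thesis unfolding setB_eq using alpha_in by blast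
qed

lemma Max_setB: "Max (setB a n) = 2 * c"
proof (rule Max_eqI)
  have "setB a n \<subseteq> {..2 * c}" using setB_le by auto
  then show "finite (setB a n)" by (rule finite_subset) simp
qed (use setB_le two_c_in_setB in auto)

lemma setB_clusters:
  "b \<in> setB a n \<Longrightarrow> b \<le> \<alpha> \<and> b \<in> subset_sums a (n-1) \<or> b = c \<or> c + \<alpha> < b"
  using subset_sums_le_alpha two_alpha_less by (auto simp: setB_eq)

lemma setB_no_double:
  assumes "e \<in> setB a n" "0 < e" "e \<le> \<alpha>"
  shows "2 * e \<notin> setB a n"
proof -
  have "e \<in> subset_sums a (n-1)" using setB_clusters[OF assms(1)] assms(3) two_alpha_less by auto
  then have "2 * e \<notin> subset_sums a (n-1)"
    using no_double_subset_sums[of "n-1" a e] superincreasing assms(2) by simp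
  then show ?thesis using setB_clusters[of "2 * e"] assms(3) two_alpha_less by auto
qed

lemma setB_three_clusters:
  assumes "submodule_product K V W (setB a n)"
  shows "three_cluster_product K V W (setB a n) \<alpha> c"
proof -
  interpret submodule_product K V W "setB a n" by (rule assms)
  show ?thesis
  proof
    show "\<exists>e\<in>setB a n. 0 < e \<and> e < c"
      using alpha_in alpha_pos two_alpha_less by (intro bexI[of _ \<alpha>]) (auto simp: setB_eq)
    show "c \<in> setB a n" by (simp add: setB_eq)
    show "2 * e \<notin> setB a n" if "e \<in> setB a n" "0 < e" "e \<le> \<alpha>" for e
      using setB_no_double that .
  qed (use setB_clusters setB_le two_alpha_less in force)+
qed

text \<open>The two outer clusters, shifted by 0 and a_n, already give all of C_n. The middle
  element adds nothing new: c lies in A_n + a_n, and c + a_n = a_(n+1) by (C1).\<close>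

lemma setC_sum: "setC a n = {b + t | b t. b \<in> setB a n \<and> t \<in> {0, a n}}"
proof
  let ?S = "{b + t | b t. b \<in> setB a n \<and> t \<in> {0, a n}}"
  have mem: "b + t \<in> ?S" if "b \<in> setB a n" "t \<in> {0, a n}" for b t using that by blast
  let ?A = "subset_sums a (n-1)"
  have C: "setC a n = (?A \<union> (\<lambda>t. t + a n) ` ?A) \<union> (\<lambda>t. t + (\<alpha> + 2 * a n)) ` (?A \<union> (\<lambda>t. t + a n) ` ?A)"
    unfolding setC_eq subset_sums_Suc a_Suc_n subset_sums_n ..
  show "setC a n \<subseteq> ?S"
  proof
    fix t assume "t \<in> setC a n"
    then obtain u where u: "u \<in> ?A"
      "t = u + 0 \<or> t = u + a n \<or> t = (u + (\<alpha> + 2 * a n)) + 0 \<or> t = (u + (\<alpha> + 2 * a n)) + a n"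
      unfolding C by (auto simp: ac_simps)
    have "u \<in> setB a n" "u + (\<alpha> + 2 * a n) \<in> setB a n" using u(1) by (auto simp: setB_eq)
    then show "t \<in> ?S" using u(2) mem by blast
  qed
  show "?S \<subseteq> setC a n"
  proof clarify
    fix b t assume b: "b \<in> setB a n" and t: "t \<in> {0, a n}"
    consider (low) "b \<in> ?A" | (mid) "b = \<alpha> + a n" | (high) u where "u \<in> ?A" "b = u + (\<alpha> + 2 * a n)"
      using b by (auto simp: setB_eq)
    then show "b + t \<in> setC a n"
    proof cases
      case low
      then show ?thesis using t unfolding C by auto
    next
      case mid
      have "\<alpha> + a n \<in> (\<lambda>t. t + a n) ` ?A" using alpha_in by blast
      moreover have "\<alpha> + 2 * a n \<in> (\<lambda>t. t + (\<alpha> + 2 * a n)) ` (?A \<union> (\<lambda>t. t + a n) ` ?A)"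
        using zero_in_subset_sums[of a "n-1"] by (intro image_eqI[of _ _ 0]) auto
      ultimately show ?thesis using t mid unfolding C by (auto simp: mult_2)
    next
      case high
      then have "b \<in> (\<lambda>t. t + (\<alpha> + 2 * a n)) ` (?A \<union> (\<lambda>t. t + a n) ` ?A)" by blast
      moreover have "b + a n = (u + a n) + (\<alpha> + 2 * a n)" using high by simp
      then have "b + a n \<in> (\<lambda>t. t + (\<alpha> + 2 * a n)) ` (?A \<union> (\<lambda>t. t + a n) ` ?A)"
        using high by blast
      ultimately show ?thesis using t unfolding C by auto
    qed
  qed
qed

end

context form_grading
begin

text \<open>The list is reversed so that the induction peels off the largest index at its
  head.\<close>

lemma ideal_prod_two_generated:
  "ideal_prod (map (\<lambda>i. mono_ideal (a i) {0, a i}) (rev [1..<Suc j]))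
    = mono_ideal (\<Sum>i\<in>{1..j}. a i) (subset_sums a j)"
proof (induction j)
  case 0
  have "1 \<in> mono_ideal 0 {0}" using mono_ideal_mem[of 0 "{0}" 0] by simp
  then have "mono_ideal 0 {0} = UNIV" by (rule is_ideal_one[OF is_ideal_mono_ideal])
  then show ?case by (simp add: ideal_prod_def subset_sums_0)
next
  case (Suc j)
  have "ideal_prod (map (\<lambda>i. mono_ideal (a i) {0, a i}) (rev [1..<Suc (Suc j)]))
    = ideal_mult (mono_ideal (a (Suc j)) {0, a (Suc j)}) (mono_ideal (\<Sum>i\<in>{1..j}. a i) (subset_sums a j))"
    using Suc by (simp add: ideal_prod_Cons)
  also have "\<dots> = mono_ideal (a (Suc j) + (\<Sum>i\<in>{1..j}. a i)) {s + t | s t. s \<in> {0, a (Suc j)} \<and> t \<in> subset_sums a j}"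
    by (rule mono_ideal_mult) (auto dest: subset_sums_le)
  also have "{s + t | s t. s \<in> {0, a (Suc j)} \<and> t \<in> subset_sums a j} = subset_sums a (Suc j)"
    by (auto simp: subset_sums_Suc) (metis add_0, metis add.commute)
  finally show ?case by (simp add: atLeastAtMostSuc_conv)
qed

lemma ideal_lengths_setC_mono_ideal:
  assumes "C1_C2_sequence a n"
  defines "IB \<equiv> mono_ideal (Max (setB a n)) (setB a n)"
    and "IC \<equiv> mono_ideal (\<Sum>i\<in>{1..n+1}. a i) (setC a n)"
  shows "ideal_atom IB \<and> {2, n+1} \<subseteq> ideal_lengths IC \<and> ideal_lengths IC \<subseteq> {2..n+1}"
proof -
  interpret S: C1_C2_sequence a n by (rule assms)
  have pos: "0 < a i" if "i \<in> {1..n+1}" for i using S.apos that by blast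
  have B_le: "setB a n \<subseteq> {..2 * S.c}" using S.setB_le by auto
  have atom_B: "ideal_atom IB"
    unfolding IB_def S.Max_setB
  proof (rule ideal_atom_mono_idealI[OF B_le S.zero_in_setB S.two_c_in_setB])
    show "0 < 2 * S.c" using S.alpha_pos by simp
    show "(\<forall>f\<in>V. degree f = 0) \<or> (\<forall>g\<in>W. degree g = 0)"
      if "submodule_product const_coeffs V W (setB a n)" for V W
      using S.setB_three_clusters[OF that] by (rule three_cluster_product.constant_factor)
  qed
  have atom_n: "ideal_atom (mono_ideal (a n) {0, a n})"
    using pos S.n2 by (intro ideal_atom_two) auto
  have IC_mult: "IC = ideal_mult IB (mono_ideal (a n) {0, a n})"
  proof -
    have "(\<Sum>i\<in>{1..n+1}. a i) = 2 * S.c + a n" using S.sum_Suc_n by simp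
    then show ?thesis
      unfolding IC_def IB_def S.Max_setB S.setC_sum using mono_ideal_mult[OF B_le, of "{0, a n}" "a n"] by simp
  qed
  have "2 \<in> ideal_lengths IC"
  proof -
    have "ideal_prod [IB, mono_ideal (a n) {0, a n}] = IC"
      by (simp add: ideal_prod_def IC_mult ideal_mult_UNIV is_ideal_mono_ideal)
    then show ?thesis
      unfolding ideal_lengths_def using atom_B atom_n
      by (intro CollectI exI[of _ "[IB, mono_ideal (a n) {0, a n}]"]) simp
  qed
  moreover have "n + 1 \<in> ideal_lengths IC"
  proof -
    let ?Js = "map (\<lambda>i. mono_ideal (a i) {0, a i}) (rev [1..<Suc (n + 1)])"
    have "ideal_prod ?Js = IC"
      unfolding ideal_prod_two_generated IC_def S.setC_eq by simp
    moreover have "\<forall>A\<in>set ?Js. ideal_atom A"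
      using pos by (auto intro!: ideal_atom_two)
    moreover have "length ?Js = n + 1" by simp
    ultimately show ?thesis unfolding ideal_lengths_def by blast
  qed
  moreover have "k \<in> {2..n+1}" if k: "k \<in> ideal_lengths IC" for k
  proof -
    have "k \<le> n + 1"
    proof -
      have C: "setC a n \<subseteq> {..\<Sum>i\<in>{1..n+1}. a i}"
        unfolding S.setC_eq by (auto dest: subset_sums_le)
      have "\<exists>s. (\<forall>i<k. 0 < s i) \<and> (\<forall>K\<subseteq>{..<k}. (\<Sum>i\<in>K. s i) \<in> setC a n)"
        by (rule ideal_lengths_subset_sums[OF C _ _ k[unfolded IC_def]])
          (use zero_in_subset_sums[of a "Suc n"] sum_in_subset_sums[of a "Suc n"] in \<open>auto simp: S.setC_eq\<close>)
      then obtain s where s: "\<forall>i<k. 0 < s i" "\<forall>K\<subseteq>{..<k}. (\<Sum>i\<in>K. s i) \<in> setC a n"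
        by blast
      then have "card {..<k} \<le> n + 1"
        by (intro S.card_le_Suc_n[of _ s]) (auto simp: S.setC_eq)
      then show ?thesis by simp
    qed
    moreover obtain Js where Js: "length Js = k" "\<forall>A\<in>set Js. ideal_atom A" "ideal_prod Js = IC"
      using k by (auto simp: ideal_lengths_def)
    have proper: "A \<noteq> UNIV" "nz_ideal A" if "ideal_atom A" for A :: "'r set"
      using that by (auto simp: ideal_atom_def)
    \<comment> \<open>Length 1 is excluded because \<open>IC\<close> is a product of two proper
      ideals, length 0 because the empty product is the whole ring.\<close>
    have not_atom: "\<not> ideal_atom IC"
      using IC_mult proper[OF atom_B] proper[OF atom_n] unfolding ideal_atom_def by blast
    have "IC \<subseteq> IB"
      unfolding IC_mult IB_def by (rule ideal_mult_subset_left[OF is_ideal_mono_ideal])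
    then have "IC \<noteq> UNIV" using proper(1)[OF atom_B] by auto
    have "k \<noteq> 0" using Js(1,3) \<open>IC \<noteq> UNIV\<close> by (auto simp: ideal_prod_def)
    moreover have "k \<noteq> 1"
    proof
      assume "k = 1"
      then obtain J where "Js = [J]" using Js(1) by (auto simp: length_Suc_conv)
      moreover have "is_ideal J" using Js(2) calculation by (auto simp: ideal_atom_def nz_ideal_def)
      ultimately have "IC = J" using Js(3) by (simp add: ideal_prod_def ideal_mult_UNIV)
      then show False using not_atom Js(2) \<open>Js = [J]\<close> by simp
    qed
    ultimately show ?thesis by auto
  qed
  ultimately show ?thesis using atom_B by blast
qed

end

theorem theorem3p5:
  fixes a :: "nat \<Rightarrow> nat" and n :: nat and x y :: "'v::finite"
  assumes N2: "CARD('v) \<ge> 2"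
    and xy: "x \<noteq> y"
    and BF: "ideal_BF TYPE(('v, 'a::idom) mpoly)"
    and n2: "n \<ge> 2"
    and apos: "\<forall>i\<in>{1..n+1}. a i > 0"
    and C1: "a (n+1) = (\<Sum>i\<in>{1..n-1}. a i) + 2 * a n"
    and C2: "\<forall>i\<in>{1..n-1}. a (i+1) > 2 * (\<Sum>j\<in>{1..i}. a j)"
  defines "IB \<equiv> ideal_gen ((\<lambda>b. monoXY x y (Max (setB a n) - b) b) ` setB a n) :: ('v, 'a) mpoly set"
    and "IC \<equiv> ideal_gen ((\<lambda>c. monoXY x y ((\<Sum>i\<in>{1..n+1}. a i) - c) c) ` setC a n) :: ('v, 'a) mpoly set"
  shows "ideal_atom IB \<and> {2, n+1} \<subseteq> ideal_lengths IC \<and> ideal_lengths IC \<subseteq> {2..n+1}"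
proof -
  \<comment> \<open>Any injective renumbering serves; one exists because the index type is
    finite.\<close>
  obtain \<iota> :: "'v \<Rightarrow> nat" where "inj \<iota>"
    using finite_imp_inj_to_nat_seg[of "UNIV :: 'v set"] by auto
  then interpret R: two_variables x y \<iota> "TYPE('a)"
    by unfold_locales (use xy in auto)
  have "C1_C2_sequence a n"
    by unfold_locales (use n2 apos C1 C2 in auto)
  from R.ideal_lengths_setC_mono_ideal[OF this] show ?thesis
    unfolding R.mono_ideal_def IB_def IC_def R.monoXY_power[symmetric] .
qed

end
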